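(* (1) Let $T_1$ and $T_2$ be two basic tiles, at least one of which is regular. Then $T_1\times T_2$ carries primitive triangulations admitting a shelling (a Morse shelling by basic tiles only) which uses only regular tiles. (2) Let $T_1$ and $T_2$ be two Morse tiles. Then $T_1\times T_2$ carries primitive triangulations admitting a Morse shelling which uses a critical tile if and only if both $T_1$ and $T_2$ are critical, and this critical tile is then unique, of index the sum of the indices of $T_1$ and $T_2$. Moreover, all these shellings are tame and pure dimensional.
   Context: A facet of a simplex is a codimension one face (the empty set is regarded as the unique facet of a $0$-simplex). A basic tile of dimension $n$ and order $k\in\{0,\dots,n+1\}$ is a closed $n$-simplex deprived of $k$ of its facets. A Morse tile of dimension $n$ and order $k$ is a closed $n$-simplex $\sigma$ (its underlying simplex) deprived of $k$ of its facets together with, if $k\ge 1$, a possibly empty face $\mu$ of codimension at least two (the Morse face); when $\mu$ is non-empty it is understood not to be contained in the removed facets, so that $k-1\le\dim\mu\le n-2$. Critical tiles: the closed simplex is critical of index $0$; the open $n$-simplex (order $n+1$) is critical of index $n$; a Morse tile of order $k$, $1\le k\le n-1$, whose Morse face has dimension $k-1$ is critical of index $k$; all other Morse tiles are regular. Let $K$ be a finite simplicial complex. A Morse tiling of a subset $S\subset|K|$ is a partition of $S$ by Morse tiles, each obtained from a simplex of $K$, such that for every $j\ge 0$ the union of the tiles of dimension $\ge j$ is closed in $S$. A Morse tiled subset of $S$ is a union of tiles closed in $S$. A Morse shelling of $S$ is a Morse tiling together with a filtration $\emptyset\subset S_1\subset\dots\subset S_N=S$ by Morse tiled subsets such that $S_1$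 and each $S_i\setminus S_{i-1}$ ($2\le i\le N$) is a single tile; it is a shelling if all tiles are basic. It is pure dimensional if all tiles have the same dimension. It is tame if there is an orientation of all edges of the underlying simplicial complex (the closure of $S$) such that (i) no triangle has boundary an oriented one-cycle; (ii) for every tile with underlying simplex $\sigma$ and non-empty Morse face $\mu$, all edges joining a vertex of $\sigma$ not in $\mu$ to a vertex of $\mu$ are oriented towards $\mu$. If $\sigma_1,\sigma_2$ are the underlying simplices of $T_1,T_2$, a primitive triangulation of $T_1\times T_2$ is a triangulation of the polytope $\sigma_1\times\sigma_2$ by affine simplices whose set of vertices is the set of vertices of $\sigma_1\times\sigma_2$; the shellings are those of the subset $T_1\times T_2$. *)

theory Defs
  imports "HOL-Analysis.Analysis"
begin

text \<open>Unlike \<^const>\<open>facet_of\<close>, this makes the empty set the unique facet of a 0-simplex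
  (\<^term>\<open>aff_dim {} = -1\<close>).\<close>

definition simplex_facets :: "'a::euclidean_space set \<Rightarrow> 'a set set" where
  "simplex_facets \<sigma> = {F. F face_of \<sigma> \<and> aff_dim F = aff_dim \<sigma> - 1}"

text \<open>Tiles are point sets. The arguments are the dimension, the order, the underlying simplex,
  the Morse face (for Morse tiles) and the tile. The set determines all of them, except that a
  point is a tile of order 0 and also one of order 1 (its only facet is empty); these agree in
  everything defined below.\<close>

definition basic_tile_on :: "nat \<Rightarrow> nat \<Rightarrow> 'a::euclidean_space set \<Rightarrow> 'a set \<Rightarrow> bool" where
  "basic_tile_on n k \<sigma> T \<longleftrightarrow>
     int n simplex \<sigma> \<and> (\<exists>\<F>. \<F> \<subseteq> simplex_facets \<sigma> \<and> card \<F> = k \<and> T = \<sigma> - \<Union>\<F>)"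

text \<open>The bound \<open>k - 1 \<le> dim \<mu>\<close> is implied: \<open>\<mu>\<close> contains the vertex opposite to each removed
  facet.\<close>

definition morse_tile_on ::
    "nat \<Rightarrow> nat \<Rightarrow> 'a::euclidean_space set \<Rightarrow> 'a set \<Rightarrow> 'a set \<Rightarrow> bool" where
  "morse_tile_on n k \<sigma> \<mu> T \<longleftrightarrow>
     int n simplex \<sigma> \<and> \<mu> face_of \<sigma> \<and>
     (\<exists>\<F>. \<F> \<subseteq> simplex_facets \<sigma> \<and> card \<F> = k \<and> T = \<sigma> - \<Union>\<F> - \<mu> \<and>
          (\<mu> \<noteq> {} \<longrightarrow> 1 \<le> k \<and> aff_dim \<mu> \<le> int n - 2 \<and> (\<forall>F\<in>\<F>. \<not> \<mu> \<subseteq> F)))"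

definition basic_tile :: "'a::euclidean_space set \<Rightarrow> bool" where
  "basic_tile T \<longleftrightarrow> (\<exists>n k \<sigma>. basic_tile_on n k \<sigma> T)"

definition morse_tile_dim :: "nat \<Rightarrow> 'a::euclidean_space set \<Rightarrow> bool" where
  "morse_tile_dim n T \<longleftrightarrow> (\<exists>k \<sigma> \<mu>. morse_tile_on n k \<sigma> \<mu> T)"

definition morse_tile :: "'a::euclidean_space set \<Rightarrow> bool" where
  "morse_tile T \<longleftrightarrow> (\<exists>n. morse_tile_dim n T)"

definition critical_tile_of_index :: "nat \<Rightarrow> 'a::euclidean_space set \<Rightarrow> bool" where
  "critical_tile_of_index i T \<longleftrightarrow>
     (i = 0 \<and> (\<exists>n \<sigma>. basic_tile_on n 0 \<sigma> T)) \<or>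
     (\<exists>n \<sigma>. basic_tile_on n (n + 1) \<sigma> T \<and> i = n) \<or>
     (\<exists>n k \<sigma> \<mu>. morse_tile_on n k \<sigma> \<mu> T \<and> 1 \<le> k \<and> k + 1 \<le> n \<and>
                aff_dim \<mu> = int k - 1 \<and> i = k)"

definition critical_tile :: "'a::euclidean_space set \<Rightarrow> bool" where
  "critical_tile T \<longleftrightarrow> (\<exists>i. critical_tile_of_index i T)"

definition regular_tile :: "'a::euclidean_space set \<Rightarrow> bool" where
  "regular_tile T \<longleftrightarrow> morse_tile T \<and> \<not> critical_tile T"

definition morse_tiling ::
    "'a::euclidean_space set set \<Rightarrow> 'a set \<Rightarrow> 'a set set \<Rightarrow> bool" where
  "morse_tiling K S \<T> \<longleftrightarrow>
     simplicial_complex K \<and> S \<subseteq> \<Union>K \<and> partition_on S \<T> \<and>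
     (\<forall>T\<in>\<T>. \<exists>\<sigma>\<in>K. \<exists>n k \<mu>. morse_tile_on n k \<sigma> \<mu> T) \<and>
     (\<forall>j. closedin (top_of_set S) (\<Union>{T \<in> \<T>. \<exists>n\<ge>j. morse_tile_dim n T}))"

definition morse_tiled_subset ::
    "'a::euclidean_space set \<Rightarrow> 'a set set \<Rightarrow> 'a set \<Rightarrow> bool" where
  "morse_tiled_subset S \<T> A \<longleftrightarrow> (\<exists>\<U>\<subseteq>\<T>. A = \<Union>\<U>) \<and> closedin (top_of_set S) A"

text \<open>The filtration is \<open>{} = P 0 \<subset> P 1 \<subset> \<dots> \<subset> P N = S\<close>.\<close>

definition morse_shelling ::
    "'a::euclidean_space set set \<Rightarrow> 'a set \<Rightarrow> 'a set set \<Rightarrow> nat \<Rightarrow> (nat \<Rightarrow> 'a set) \<Rightarrow> bool" where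
  "morse_shelling K S \<T> N P \<longleftrightarrow>
     morse_tiling K S \<T> \<and> P 0 = {} \<and> P N = S \<and>
     (\<forall>i\<le>N. morse_tiled_subset S \<T> (P i)) \<and>
     (\<forall>i<N. P i \<subset> P (Suc i) \<and> P (Suc i) - P i \<in> \<T>)"

definition shelling ::
    "'a::euclidean_space set set \<Rightarrow> 'a set \<Rightarrow> 'a set set \<Rightarrow> nat \<Rightarrow> (nat \<Rightarrow> 'a set) \<Rightarrow> bool" where
  "shelling K S \<T> N P \<longleftrightarrow> morse_shelling K S \<T> N P \<and> (\<forall>T\<in>\<T>. basic_tile T)"

definition pure_dimensional :: "'a::euclidean_space set set \<Rightarrow> bool" where
  "pure_dimensional \<T> \<longleftrightarrow> (\<exists>n. \<forall>T\<in>\<T>. morse_tile_dim n T)"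

definition underlying_complex ::
    "'a::euclidean_space set set \<Rightarrow> 'a set \<Rightarrow> 'a set set" where
  "underlying_complex K S = {\<tau> \<in> K. \<tau> \<subseteq> closure S}"

text \<open>\<open>(u, v) \<in> r\<close> means that the edge joining \<open>u\<close> and \<open>v\<close> is oriented from \<open>u\<close> to \<open>v\<close>.\<close>

definition edge_orientation :: "'a::euclidean_space set set \<Rightarrow> ('a \<times> 'a) set \<Rightarrow> bool" where
  "edge_orientation L r \<longleftrightarrow>
     (\<forall>(u, v)\<in>r. u \<noteq> v \<and> convex hull {u, v} \<in> L) \<and>
     (\<forall>u v. u \<noteq> v \<and> convex hull {u, v} \<in> L \<longrightarrow> ((u, v) \<in> r \<longleftrightarrow> (v, u) \<notin> r))"

text \<open>In (i), \<open>u\<close>, \<open>v\<close>, \<open>w\<close> are the vertices of the triangle: three points whose convex hull is a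
  2-simplex are its extreme points.\<close>

definition tame ::
    "'a::euclidean_space set set \<Rightarrow> 'a set \<Rightarrow> 'a set set \<Rightarrow> bool" where
  "tame K S \<T> \<longleftrightarrow>
     (\<exists>r. edge_orientation (underlying_complex K S) r \<and>
        (\<forall>u v w. convex hull {u, v, w} \<in> underlying_complex K S \<and> 2 simplex convex hull {u, v, w}
           \<longrightarrow> \<not> ((u, v) \<in> r \<and> (v, w) \<in> r \<and> (w, u) \<in> r)) \<and>
        (\<forall>T\<in>\<T>. \<forall>n k \<sigma> \<mu>. morse_tile_on n k \<sigma> \<mu> T \<and> \<mu> \<noteq> {} \<longrightarrow>
           (\<forall>u v. u extreme_point_of \<sigma> \<and> u \<notin> \<mu> \<and> v extreme_point_of \<mu> \<longrightarrow> (u, v) \<in> r)))"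

definition primitive_triangulation ::
    "('a::euclidean_space \<times> 'b::euclidean_space) set set \<Rightarrow> 'a set \<Rightarrow> 'b set \<Rightarrow> bool" where
  "primitive_triangulation K \<sigma>1 \<sigma>2 \<longleftrightarrow>
     simplicial_complex K \<and> \<Union>K = \<sigma>1 \<times> \<sigma>2 \<and>
     {v. {v} \<in> K} = {v. v extreme_point_of (\<sigma>1 \<times> \<sigma>2)}"

end

theory Submission
  imports Defs
begin

text \<open>The proof turns tiles into families of vertex sets and then works with lattice paths.

A point of a simplex has a support: the vertices with non-zero barycentric coordinate. Let \<open>A\<close> be
the set of vertices opposite to the removed facets of a tile and \<open>M\<close> the set of vertices of its
Morse face. The tile consists of the points whose support contains \<open>A\<close> and is not contained in
\<open>M\<close>. Removing a face of codimension one in this way is the same as adding its opposite vertex to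
\<open>A\<close>; with this convention the critical tiles of index \<open>k\<close> are exactly those with \<open>A = M\<close> of
cardinality \<open>k\<close>, for \<open>k = 0, \<dots>, n\<close>, the open simplex included (\<open>critical_tile_symmetric_data\<close>).
The vertices can be numbered such that \<open>A = {..<a}\<close> and \<open>M = {..<m}\<close> (\<open>vertex_labelling\<close>).

These numberings give the staircase triangulation of the product: its vertices are the points of
the grid \<open>{..n1} \<times> {..n2}\<close>, its simplices are the chains of the grid
(\<open>staircase_realization\<close>), and its facets are the monotone lattice paths. The product of the two
tiles consists of the open simplices of the chains that meet the first \<open>a1\<close> columns and the first
\<open>a2\<close> rows, and are contained neither in the first \<open>m1\<close> columns nor in the first \<open>m2\<close> rows.

The facets are added in the order of increasing area below the path. A chain first occurs in the
lowest path through it, and that path is characterised by the condition that the chain contains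
all its corners at which it turns from up to right. A column of the path
of more than one cell, other than the last column, ends in such a corner, so the chain meets it; only
one-cell columns impose a condition, namely to contain that cell. The same holds for rows, except
for the row 0. The last column is never prescribed if \<open>a1 \<le> n1\<close>, and the row 0 does no harm
if the column 0 is prescribed as well. So the new chains of a path are those which contain a certain
set of cells, its restriction (\<open>restriction_iff\<close>), and are not contained in the early part of the
path, i.e. in its part in the first \<open>m1\<close> columns or in its part in the first \<open>m2\<close> rows. Both
parts are initial segments of the path, hence nested, and the new chains form a Morse tile. Orienting
all edges downwards makes the shelling tame, because the Morse faces are initial segments.

A tile is critical if the restriction is the early part of its path, since the restriction is never
the whole path (\<open>restriction_proper\<close>). If the first tile is regular,
this never happens (\<open>restriction_noncritical\<close>). If \<open>a1 = m1\<close> and \<open>a2 = m2\<close> it happens exactly for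
the path that goes up by \<open>m2\<close>, then right to the end and then up (\<open>critical_path_unique\<close>), and the
restriction has \<open>m1 + m2\<close> elements. The remaining cases follow by exchanging the two factors.\<close>

section \<open>Faces of a simplex and supports of its points\<close>

definition vertex_support :: "'a::euclidean_space set \<Rightarrow> 'a \<Rightarrow> 'a set" where
  "vertex_support V x = {v \<in> V. x \<notin> convex hull (V - {v})}"

lemma vertex_support_subset: "vertex_support V x \<subseteq> V"
  by (auto simp: vertex_support_def)

text \<open>The support of a point is the smallest set of vertices that has the point in its convex hull, because
the convex hulls of subsets of an affinely independent set intersect in the hull of the intersection.\<close>

lemma mem_hull_subset_iff:
  fixes V :: "'a::euclidean_space set"
  assumes V: "\<not> affine_dependent V" and B: "B \<subseteq> V"
  shows "x \<in> convex hull B \<longleftrightarrow> x \<in> convex hull V \<and> vertex_support V x \<subseteq> B"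
proof
  assume x: "x \<in> convex hull B"
  have "u \<in> B" if "u \<in> vertex_support V x" for u
  proof (rule ccontr)
    assume "u \<notin> B"
    then have "B \<subseteq> V - {u}" using B by blast
    then have "x \<in> convex hull (V - {u})" using x hull_mono by blast
    then show False using that by (simp add: vertex_support_def)
  qed
  then show "x \<in> convex hull V \<and> vertex_support V x \<subseteq> B"
    using x hull_mono[OF B] by blast
next
  assume x: "x \<in> convex hull V \<and> vertex_support V x \<subseteq> B"
  show "x \<in> convex hull B"
  proof (cases "B = V")
    case False
    let ?\<S> = "(\<lambda>u. V - {u}) ` (V - B)"
    have "\<Union>?\<S> \<subseteq> V" by blast
    then have "\<not> affine_dependent (\<Union>?\<S>)" using V affine_dependent_subset by blast
    then have "convex hull (\<Inter>?\<S>) = (\<Inter>T\<in>?\<S>. convex hull T)" by (rule convex_hull_Inter)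
    moreover have "\<Inter>?\<S> = B" using B False by auto
    moreover have "x \<in> (\<Inter>T\<in>?\<S>. convex hull T)"
      using x by (auto simp: vertex_support_def)
    ultimately show ?thesis by simp
  qed (use x in simp)
qed

lemma vertex_support_nonempty:
  assumes "\<not> affine_dependent V" "x \<in> convex hull V"
  shows "vertex_support V x \<noteq> {}"
  using mem_hull_subset_iff[OF assms(1), of "{}" x] assms(2) by auto

lemma hull_subset_facet_iff:
  fixes V :: "'a::euclidean_space set"
  assumes "\<not> affine_dependent V" "M \<subseteq> V" "v \<in> V"
  shows "convex hull M \<subseteq> convex hull (V - {v}) \<longleftrightarrow> v \<notin> M"
proof
  assume "convex hull M \<subseteq> convex hull (V - {v})"
  then show "v \<notin> M"
    using assms by (metis Diff_subset affine_dependent_def convex_hull_subset_affine_hull hull_inc subset_iff)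
next
  assume "v \<notin> M"
  then show "convex hull M \<subseteq> convex hull (V - {v})"
    using assms(2) by (intro hull_mono) auto
qed

lemma vertex_support_rel_interior:
  fixes V :: "'a::euclidean_space set"
  assumes V: "\<not> affine_dependent V" and x: "x \<in> rel_interior (convex hull V)"
  shows "vertex_support V x = V"
proof -
  have "v \<in> vertex_support V x" if "v \<in> V" for v
  proof (rule ccontr)
    assume "v \<notin> vertex_support V x"
    then have "x \<in> convex hull (V - {v})" using that by (simp add: vertex_support_def)
    moreover have "convex hull (V - {v}) face_of convex hull V"
      using face_of_convex_hull_affine_independent[OF V] by blast
    moreover have "convex hull (V - {v}) \<noteq> convex hull V"
      using hull_subset_facet_iff[OF V order_refl that] that by auto
    ultimately show False using face_of_disjoint_rel_interior x by blast
  qed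
  then show ?thesis using vertex_support_subset by blast
qed

lemma exists_vertex_support:
  fixes V :: "'a::euclidean_space set"
  assumes V: "\<not> affine_dependent V" and B: "B \<subseteq> V" "B \<noteq> {}"
  shows "\<exists>x\<in>convex hull B. vertex_support V x = B"
proof -
  have Bi: "\<not> affine_dependent B" using V B(1) by (rule affine_independent_subset)
  have "rel_interior (convex hull B) \<noteq> {}" by (simp add: B(2) rel_interior_eq_empty)
  then obtain x where x: "x \<in> rel_interior (convex hull B)" by blast
  then have xB: "x \<in> convex hull B" using rel_interior_subset by blast
  then have xV: "x \<in> convex hull V" and sub: "vertex_support V x \<subseteq> B"
    using mem_hull_subset_iff[OF V B(1), of x] by simp_all
  have "x \<in> convex hull (vertex_support V x)"
    using mem_hull_subset_iff[OF V vertex_support_subset, of x x] xV by simp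
  then have "B \<subseteq> vertex_support V x"
    using mem_hull_subset_iff[OF Bi sub, of x] vertex_support_rel_interior[OF Bi x] by simp
  then show ?thesis using xB sub by blast
qed

lemma aff_dim_hull_subset:
  fixes V :: "'a::euclidean_space set"
  assumes "\<not> affine_dependent V" "B \<subseteq> V"
  shows "aff_dim (convex hull B) = int (card B) - 1"
  using affine_independent_subset[OF assms] aff_dim_affine_independent[of B]
  by (simp add: aff_dim_convex_hull)

lemma simplex_facets_hull:
  fixes V :: "'a::euclidean_space set"
  assumes V: "\<not> affine_dependent V"
  shows "simplex_facets (convex hull V) = (\<lambda>v. convex hull (V - {v})) ` V"
proof -
  have fin: "finite V" using V aff_independent_finite by blast
  note dim = aff_dim_hull_subset[OF V]
  have "(\<exists>c\<subseteq>V. F = convex hull c) \<and> aff_dim F = int (card V) - 2 \<longleftrightarrow>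
        (\<exists>v\<in>V. F = convex hull (V - {v}))" for F
  proof
    assume "(\<exists>c\<subseteq>V. F = convex hull c) \<and> aff_dim F = int (card V) - 2"
    then obtain c where c: "c \<subseteq> V" "F = convex hull c" "aff_dim F = int (card V) - 2" by blast
    then have "int (card c) = int (card V) - 1" using dim[OF c(1)] by simp
    then have "card (V - c) = 1" using c(1) fin
      by (simp add: card_Diff_subset finite_subset)
    then obtain v where "V - c = {v}" by (meson card_1_singletonE)
    then have "c = V - {v}" "v \<in> V" using c(1) by blast+
    then show "\<exists>v\<in>V. F = convex hull (V - {v})" using c(2) by blast
  next
    assume "\<exists>v\<in>V. F = convex hull (V - {v})"
    then obtain v where v: "v \<in> V" "F = convex hull (V - {v})" by blast
    have "card V \<ge> 1" using v(1) fin by (metis One_nat_def Suc_leI card_gt_0_iff empty_iff)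
    then show "(\<exists>c\<subseteq>V. F = convex hull c) \<and> aff_dim F = int (card V) - 2"
      using v dim[of "V - {v}"] fin by (auto simp: card_Diff_singleton)
  qed
  then show ?thesis
    using dim[of V] by (auto simp: simplex_facets_def face_of_convex_hull_affine_independent[OF V])
qed

section \<open>Tiles described by vertices\<close>

definition vertex_tile :: "'a::euclidean_space set \<Rightarrow> 'a set \<Rightarrow> 'a set \<Rightarrow> 'a set" where
  "vertex_tile V A M =
     {x \<in> convex hull V. A \<subseteq> vertex_support V x \<and> \<not> vertex_support V x \<subseteq> M}"

text \<open>Here \<open>M\<close> may have codimension one and need not contain \<open>A\<close>. The product of two tiles decomposes
naturally into tiles given by such data.\<close>

definition tile_data :: "'a::euclidean_space set \<Rightarrow> 'a set \<Rightarrow> 'a set \<Rightarrow> bool" where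
  "tile_data V A M \<longleftrightarrow>
     \<not> affine_dependent V \<and> A \<subseteq> V \<and> M \<subset> V \<and> (M \<noteq> {} \<longrightarrow> A \<noteq> {})"

text \<open>The data of a Morse tile in the strict sense.\<close>

definition reduced_tile_data :: "'a::euclidean_space set \<Rightarrow> 'a set \<Rightarrow> 'a set \<Rightarrow> bool" where
  "reduced_tile_data V A M \<longleftrightarrow>
     tile_data V A M \<and> (M \<noteq> {} \<longrightarrow> A \<subseteq> M \<and> card M + 2 \<le> card V)"

text \<open>A facet of a simplex corresponds to the vertex opposite to it, also for a 0-simplex, whose only facet is
empty. Under this correspondence the Morse face is not contained in a removed facet if and only if it
contains the opposite vertex.\<close>

lemma morse_tile_on_iff_vertex_tile:
  fixes T :: "'a::euclidean_space set"
  shows "morse_tile_on n k \<sigma> \<mu> T \<longleftrightarrow>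
    (\<exists>V A M. reduced_tile_data V A M \<and> card V = n + 1 \<and> card A = k \<and>
       \<sigma> = convex hull V \<and> \<mu> = convex hull M \<and> T = vertex_tile V A M)"
proof -
  have inj: "inj_on (\<lambda>v. convex hull (V - {v})) V" if V: "\<not> affine_dependent V" for V :: "'a set"
  proof (rule inj_onI)
    fix u v assume "u \<in> V" "v \<in> V" "convex hull (V - {u}) = convex hull (V - {v})"
    then show "u = v"
      using hull_subset_facet_iff[OF V, of "V - {u}" v] by auto
  qed
  have key: "(convex hull V) - \<Union>((\<lambda>v. convex hull (V - {v})) ` A) - convex hull M = vertex_tile V A M"
    if V: "\<not> affine_dependent V" "A \<subseteq> V" "M \<subseteq> V" for V A M :: "'a set"
  proof -
    have "x \<in> convex hull (V - {a}) \<longleftrightarrow> a \<notin> vertex_support V x"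
      if "x \<in> convex hull V" "a \<in> A" for x a
      using that V by (auto simp: vertex_support_def)
    then show ?thesis using mem_hull_subset_iff[OF V(1,3)]
      by (fastforce simp: vertex_tile_def)
  qed
  show ?thesis
  proof
    assume "morse_tile_on n k \<sigma> \<mu> T"
    then obtain \<F> where \<F>: "int n simplex \<sigma>" "\<mu> face_of \<sigma>" "\<F> \<subseteq> simplex_facets \<sigma>" "card \<F> = k"
      "T = \<sigma> - \<Union>\<F> - \<mu>"
      "\<mu> \<noteq> {} \<Longrightarrow> 1 \<le> k \<and> aff_dim \<mu> \<le> int n - 2 \<and> (\<forall>F\<in>\<F>. \<not> \<mu> \<subseteq> F)"
      unfolding morse_tile_on_def by blast
    obtain V where V: "\<not> affine_dependent V" "card V = n + 1" "\<sigma> = convex hull V"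
      using \<F>(1) unfolding simplex_def by auto
    obtain M where M: "M \<subseteq> V" "\<mu> = convex hull M"
      using \<F>(2) V face_of_convex_hull_affine_independent by blast
    obtain A where A: "A \<subseteq> V" "\<F> = (\<lambda>v. convex hull (V - {v})) ` A"
      using \<F>(3) V simplex_facets_hull by (metis subset_imageE)
    have cA: "card A = k" using \<F>(4) A inj[OF V(1)] by (metis card_image inj_on_subset)
    have big: "A \<noteq> {} \<and> A \<subseteq> M \<and> card M + 2 \<le> card V" if "M \<noteq> {}"
    proof -
      have "\<mu> \<noteq> {}" using that M by simp
      note f = \<F>(6)[OF this]
      have "a \<in> M" if "a \<in> A" for a
        using f that A M hull_subset_facet_iff[OF V(1) M(1), of a] by auto
      moreover have "card M + 2 \<le> card V" using f aff_dim_hull_subset[OF V(1) M(1)] M(2) V(2) by simp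
      moreover have "A \<noteq> {}" using f cA by auto
      ultimately show ?thesis by blast
    qed
    moreover have "M \<subset> V" using big M V by fastforce
    ultimately have "reduced_tile_data V A M"
      using V A M by (auto simp: reduced_tile_data_def tile_data_def)
    then show "\<exists>V A M. reduced_tile_data V A M \<and> card V = n + 1 \<and> card A = k \<and>
       \<sigma> = convex hull V \<and> \<mu> = convex hull M \<and> T = vertex_tile V A M"
      using V M cA \<F>(5) A key[OF V(1) A(1) M(1)] by blast
  next
    assume "\<exists>V A M. reduced_tile_data V A M \<and> card V = n + 1 \<and> card A = k \<and>
       \<sigma> = convex hull V \<and> \<mu> = convex hull M \<and> T = vertex_tile V A M"
    then obtain V A M where *: "reduced_tile_data V A M" "card V = n + 1" "card A = k"
       "\<sigma> = convex hull V" "\<mu> = convex hull M" "T = vertex_tile V A M" by blast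
    then have V: "\<not> affine_dependent V" "A \<subseteq> V" "M \<subseteq> V"
      "M \<noteq> {} \<Longrightarrow> A \<noteq> {} \<and> A \<subseteq> M \<and> card M + 2 \<le> card V"
      by (auto simp: reduced_tile_data_def tile_data_def)
    let ?\<F> = "(\<lambda>v. convex hull (V - {v})) ` A"
    have "finite A" using V aff_independent_finite finite_subset by metis
    then have "A \<noteq> {} \<Longrightarrow> 1 \<le> k" using *(3) by (metis One_nat_def Suc_leI card_gt_0_iff)
    moreover have "int n simplex \<sigma>" using V * by (auto simp: simplex_def)
    moreover have "\<mu> face_of \<sigma>" using V * face_of_convex_hull_affine_independent by blast
    moreover have "?\<F> \<subseteq> simplex_facets \<sigma>" using V * simplex_facets_hull by blast
    moreover have "card ?\<F> = k" using *(3) inj[OF V(1)] V(2) by (metis card_image inj_on_subset)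
    moreover have "T = \<sigma> - \<Union>?\<F> - \<mu>" using key[OF V(1-3)] * by simp
    moreover have "\<forall>F\<in>?\<F>. \<not> \<mu> \<subseteq> F" if "\<mu> \<noteq> {}"
    proof -
      have "a \<in> M" "a \<in> V" if "a \<in> A" for a
        using that V(2,4) * \<open>\<mu> \<noteq> {}\<close> by auto
      then show ?thesis using * hull_subset_facet_iff[OF V(1,3)] by auto
    qed
    moreover have "aff_dim \<mu> \<le> int n - 2" if "\<mu> \<noteq> {}"
      using that V * aff_dim_hull_subset[OF V(1,3)] by auto
    moreover have "1 \<le> k" if "\<mu> \<noteq> {}"
      using that V(4) * \<open>A \<noteq> {} \<Longrightarrow> 1 \<le> k\<close> by auto
    ultimately show "morse_tile_on n k \<sigma> \<mu> T"
      unfolding morse_tile_on_def by (intro conjI exI[of _ ?\<F>] impI) simp_all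
  qed
qed

lemma basic_tile_on_iff_morse: "basic_tile_on n k \<sigma> T \<longleftrightarrow> morse_tile_on n k \<sigma> {} T"
  unfolding basic_tile_on_def morse_tile_on_def by auto

text \<open>A tile contains the relative interior of its simplex.\<close>

lemma vertex_tile_closure:
  assumes "tile_data V A M"
  shows "closure (vertex_tile V A M) = convex hull V"
proof -
  have V: "\<not> affine_dependent V" "A \<subseteq> V" "M \<subset> V" using assms by (auto simp: tile_data_def)
  have fin: "finite V" using V aff_independent_finite by blast
  have "rel_interior (convex hull V) \<subseteq> vertex_tile V A M"
    using vertex_support_rel_interior[OF V(1)] rel_interior_subset[of "convex hull V"] V(2,3)
    unfolding vertex_tile_def by fastforce
  moreover have "closure (rel_interior (convex hull V)) = convex hull V"
    by (simp add: convex_closure_rel_interior closure_closed compact_imp_closed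
        finite_imp_compact_convex_hull fin)
  moreover have "closure (vertex_tile V A M) \<subseteq> convex hull V"
    by (rule closure_minimal) (auto simp: vertex_tile_def compact_imp_closed finite_imp_compact_convex_hull fin)
  ultimately show ?thesis using closure_mono by (metis subset_antisym)
qed

lemma vertex_tile_subset_iff:
  assumes V: "\<not> affine_dependent V" and "vertex_tile V A M = vertex_tile V A' M'"
    and B: "B \<subseteq> V" "B \<noteq> {}"
  shows "A \<subseteq> B \<and> \<not> B \<subseteq> M \<longleftrightarrow> A' \<subseteq> B \<and> \<not> B \<subseteq> M'"
proof -
  obtain x where x: "x \<in> convex hull B" "vertex_support V x = B"
    using exists_vertex_support[OF V B] by blast
  then have "x \<in> convex hull V" using hull_mono[OF B(1)] by blast
  then have "x \<in> vertex_tile V A M \<longleftrightarrow> A \<subseteq> B \<and> \<not> B \<subseteq> M"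
    "x \<in> vertex_tile V A' M' \<longleftrightarrow> A' \<subseteq> B \<and> \<not> B \<subseteq> M'"
    using x(2) by (simp_all add: vertex_tile_def)
  then show ?thesis using assms(2) by simp
qed

text \<open>The simplex is the closure of the tile. A vertex is in \<open>A\<close> if and only if the open facet opposite to
it is missing in the tile, and then a non-empty \<open>M\<close> is the largest set containing \<open>A\<close> whose open face is
missing. The open facet of a point is empty, whence the exception.\<close>

lemma vertex_tile_unique:
  assumes d: "reduced_tile_data V A M" "reduced_tile_data V' A' M'"
    and eq: "vertex_tile V A M = vertex_tile V' A' M'"
  shows "V' = V" "M' = M" "A' = A \<or> card V = 1"
proof -
  have V: "\<not> affine_dependent V" "\<not> affine_dependent V'"
    using d by (auto simp: reduced_tile_data_def tile_data_def)
  have hulls: "convex hull V = convex hull V'"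
    using vertex_tile_closure[of V A M] vertex_tile_closure[of V' A' M'] d eq
    by (simp add: reduced_tile_data_def)
  then have "v \<in> V' \<longleftrightarrow> v \<in> V" for v
    using extreme_point_of_convex_hull_affine_independent[OF V(1), of v]
      extreme_point_of_convex_hull_affine_independent[OF V(2), of v] by simp
  then show VV: "V' = V" by blast
  have fin: "finite V" using V(1) by (rule aff_independent_finite)
  have AV: "A \<subseteq> V" "A' \<subseteq> V" and MV: "M \<subset> V" "M' \<subset> V"
    using d VV by (auto simp: reduced_tile_data_def tile_data_def)
  note iff = vertex_tile_subset_iff[OF V(1) eq[unfolded VV]]
  have A_iff: "v \<in> B \<longleftrightarrow> \<not> (B \<subseteq> V - {v} \<and> \<not> V - {v} \<subseteq> N)"
    if "reduced_tile_data V B N" "v \<in> V" "card V \<noteq> 1" for B N v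
  proof -
    have "\<not> V - {v} \<subseteq> N"
    proof (cases "N = {}")
      case True
      have "V \<noteq> {v}" using that(3) by auto
      then show ?thesis using True that(2) by blast
    next
      case False
      then have "card N + 2 \<le> card V" "N \<subseteq> V" using that by (auto simp: reduced_tile_data_def tile_data_def)
      moreover have "card (V - {v}) = card V - 1" using that fin by simp
      ultimately show ?thesis using card_mono[of N "V - {v}"] fin finite_subset by fastforce
    qed
    then show ?thesis using that by (auto simp: reduced_tile_data_def tile_data_def)
  qed
  show AA: "A' = A \<or> card V = 1"
  proof (rule disjCI)
    assume c: "card V \<noteq> 1"
    have "v \<in> A' \<longleftrightarrow> v \<in> A" if v: "v \<in> V" for v
    proof -
      have "V \<noteq> {v}" using c by auto
      then have "V - {v} \<noteq> {}" using v by blast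
      then show ?thesis
        using A_iff[OF d(1) v c] A_iff[OF d(2)[unfolded VV] v c] iff[of "V - {v}"] by blast
    qed
    then show "A' = A" using AV by blast
  qed
  show "M' = M"
  proof (cases "card V = 1")
    case True
    then obtain v where "V = {v}" by (rule card_1_singletonE)
    then show ?thesis using MV by blast
  next
    case False
    then have "A' = A" using AA by blast
    then show ?thesis
      using iff[of M] iff[of M'] d VV MV
      by (auto simp: reduced_tile_data_def tile_data_def)
  qed
qed

text \<open>The index of a critical tile, read off the vertices.\<close>

definition critical_data :: "'a set \<Rightarrow> 'a set \<Rightarrow> 'a set \<Rightarrow> nat \<Rightarrow> bool" where
  "critical_data V A M i \<longleftrightarrow> A = M \<and> i = card A \<or> A = V \<and> i + 1 = card V"

lemma critical_reduced_iff:
  assumes d: "reduced_tile_data V A M"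
  shows "critical_tile_of_index i (vertex_tile V A M) \<longleftrightarrow> critical_data V A M i"
proof -
  have V: "\<not> affine_dependent V" "A \<subseteq> V" "M \<subset> V"
    using d by (auto simp: reduced_tile_data_def tile_data_def)
  have fin: "finite V" using V(1) by (rule aff_independent_finite)
  have finA: "finite A" using V(2) fin finite_subset by blast
  obtain n where n: "card V = n + 1"
    using V(3) fin by (metis Suc_eq_plus1 card_0_eq not0_implies_Suc not_psubset_empty)
  \<comment> \<open>A point has two descriptions as a tile, of order 0 and of order 1; both give the index 0.\<close>
  have single: "M = {} \<and> (A = {} \<or> A = V)" if c: "card V = 1"
  proof -
    obtain v where "V = {v}" using c by (rule card_1_singletonE)
    then show ?thesis using V by blast
  qed
  show ?thesis
  proof
    assume "critical_tile_of_index i (vertex_tile V A M)"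
    then consider
        (closed) n \<sigma> where "morse_tile_on n 0 \<sigma> {} (vertex_tile V A M)" "i = 0"
      | (opened) n \<sigma> where "morse_tile_on n (n + 1) \<sigma> {} (vertex_tile V A M)" "i = n"
      | (between) n k \<sigma> \<mu> where "morse_tile_on n k \<sigma> \<mu> (vertex_tile V A M)" "1 \<le> k"
          "k + 1 \<le> n" "aff_dim \<mu> = int k - 1" "i = k"
      unfolding critical_tile_of_index_def basic_tile_on_iff_morse by blast
    then show "critical_data V A M i"
    proof cases
      case closed
      then obtain V' A' M' where *: "reduced_tile_data V' A' M'" "card A' = 0"
          "convex hull M' = {}" "vertex_tile V A M = vertex_tile V' A' M'"
        unfolding morse_tile_on_iff_vertex_tile by metis
      have u: "V' = V" "M' = M" "A' = A \<or> card V = 1"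
        using vertex_tile_unique[OF d *(1,4)] by blast+
      have "finite A'"
        using * u fin finite_subset by (auto simp: reduced_tile_data_def tile_data_def)
      then have "A' = {}" "M = {}" using * u by auto
      then show ?thesis using u(3) single closed(2) n by (auto simp: critical_data_def)
    next
      case (opened n')
      then obtain V' A' M' where *: "reduced_tile_data V' A' M'" "card A' = n' + 1"
          "card V' = n' + 1" "vertex_tile V A M = vertex_tile V' A' M'"
        unfolding morse_tile_on_iff_vertex_tile by metis
      have u: "V' = V" "M' = M" "A' = A \<or> card V = 1"
        using vertex_tile_unique[OF d *(1,4)] by blast+
      have "A' \<subseteq> V" using * u by (auto simp: reduced_tile_data_def tile_data_def)
      then have "A' = V" using *(2,3) u(1) fin by (metis card_subset_eq)
      then show ?thesis using u(1,3) single opened(2) *(3)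
        by (cases "card V = 1") (auto simp: critical_data_def)
    next
      case (between n' k \<sigma> \<mu>)
      then obtain V' A' M' where *: "reduced_tile_data V' A' M'" "card V' = n' + 1" "card A' = k"
          "\<mu> = convex hull M'" "vertex_tile V A M = vertex_tile V' A' M'"
        unfolding morse_tile_on_iff_vertex_tile by metis
      have u: "V' = V" "M' = M" "A' = A \<or> card V = 1"
        using vertex_tile_unique[OF d *(1,5)] by blast+
      have c1: "card V \<noteq> 1" using between(3) *(2) u(1) by simp
      have cM: "card M = k" using between(4) *(4) u(2) aff_dim_hull_subset[OF V(1), of M] V(3) by auto
      then have "M \<noteq> {}" using between(2) by auto
      then have "A \<subseteq> M" using d by (simp add: reduced_tile_data_def)
      moreover have "finite M" using V(3) fin finite_subset by blast
      ultimately have "A = M" using cM *(3) u(3) c1 by (metis card_subset_eq)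
      then show ?thesis using cM between(5) by (simp add: critical_data_def)
    qed
  next
    assume c: "critical_data V A M i"
    have tile: "morse_tile_on n (card A) (convex hull V) (convex hull M) (vertex_tile V A M)"
      using d n unfolding morse_tile_on_iff_vertex_tile by blast
    show "critical_tile_of_index i (vertex_tile V A M)"
    proof (cases "A = V")
      case True
      then have "M = {}" using d by (auto simp: reduced_tile_data_def tile_data_def)
      moreover from this have "i = n" if "A \<noteq> M \<or> i \<noteq> 0" using c that n True
        by (auto simp: critical_data_def)
      moreover have "A \<noteq> M" using True V(3) by blast
      ultimately show ?thesis using tile n True
        unfolding critical_tile_of_index_def basic_tile_on_iff_morse by auto
    next
      case False
      then have AM: "A = M" "i = card A" using c by (auto simp: critical_data_def)
      show ?thesis
      proof (cases "M = {}")
        case True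
        then show ?thesis using tile AM
          unfolding critical_tile_of_index_def basic_tile_on_iff_morse by auto
      next
        case False
        then have "card A + 1 \<le> n" using d AM n by (auto simp: reduced_tile_data_def)
        moreover have "1 \<le> card A" using False AM finA by (metis One_nat_def Suc_leI card_gt_0_iff)
        moreover have "aff_dim (convex hull M) = int (card A) - 1"
          using aff_dim_hull_subset[OF V(1), of M] V(3) AM(1) by blast
        ultimately show ?thesis using tile AM unfolding critical_tile_of_index_def by blast
      qed
    qed
  qed
qed

lemma vertex_tile_cong:
  assumes V: "\<not> affine_dependent V"
    and "\<And>s. s \<subseteq> V \<Longrightarrow> s \<noteq> {} \<Longrightarrow> A \<subseteq> s \<and> \<not> s \<subseteq> M \<longleftrightarrow> A' \<subseteq> s \<and> \<not> s \<subseteq> M'"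
  shows "vertex_tile V A M = vertex_tile V A' M'"
proof -
  have "A \<subseteq> vertex_support V x \<and> \<not> vertex_support V x \<subseteq> M \<longleftrightarrow>
        A' \<subseteq> vertex_support V x \<and> \<not> vertex_support V x \<subseteq> M'" if "x \<in> convex hull V" for x
    using assms(2)[OF vertex_support_subset vertex_support_nonempty[OF V that]] .
  then show ?thesis unfolding vertex_tile_def by blast
qed

text \<open>If \<open>M\<close> does not contain \<open>A\<close>, it excludes no support. If it has codimension one, avoiding its
subsets amounts to containing the remaining vertex. The notion of criticality is chosen such that it
is insensitive to this change.\<close>

lemma vertex_tile_reduce:
  assumes d: "tile_data V A M"
  shows "\<exists>A' M'. reduced_tile_data V A' M' \<and> vertex_tile V A' M' = vertex_tile V A M \<and>
    (\<forall>i. critical_data V A' M' i \<longleftrightarrow> critical_data V A M i) \<and> (M' = {} \<or> M' = M)"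
proof -
  have V: "\<not> affine_dependent V" "A \<subseteq> V" "M \<subset> V" "M \<noteq> {} \<Longrightarrow> A \<noteq> {}"
    using d by (auto simp: tile_data_def)
  have fin: "finite V" using V(1) by (rule aff_independent_finite)
  have lt: "card M < card V" using V(3) fin by (simp add: psubset_card_mono)
  consider "M = {} \<or> A \<subseteq> M \<and> card M + 2 \<le> card V" | "M \<noteq> {}" "\<not> A \<subseteq> M"
    | "M \<noteq> {}" "A \<subseteq> M" "card M + 1 = card V" using lt by linarith
  then show ?thesis
  proof cases
    case 1
    then have "reduced_tile_data V A M" using d by (auto simp: reduced_tile_data_def)
    then show ?thesis by blast
  next
    case 2
    have "reduced_tile_data V A {}" using V by (auto simp: reduced_tile_data_def tile_data_def)
    moreover have "vertex_tile V A {} = vertex_tile V A M"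
      by (rule vertex_tile_cong[OF V(1)]) (use 2 in blast)
    moreover have "critical_data V A {} i \<longleftrightarrow> critical_data V A M i" for i
      using 2 by (auto simp: critical_data_def)
    ultimately show ?thesis by (intro exI[of _ A] exI[of _ "{}"]) simp
  next
    case 3
    have "card (V - M) = 1" using 3 V(3) fin
      by (metis add_diff_cancel_left' card_Diff_subset finite_subset psubset_imp_subset)
    then obtain v where v: "V - M = {v}" by (meson card_1_singletonE)
    \<comment> \<open>The complement of \<open>M\<close> is one vertex, and it becomes a vertex that every support has to contain.\<close>
    let ?A = "insert v A"
    have vV: "v \<in> V" "v \<notin> M" and VM: "V = insert v M" using v V(3) by blast+
    have "reduced_tile_data V ?A {}" using V vV by (auto simp: reduced_tile_data_def tile_data_def)
    moreover have "vertex_tile V ?A {} = vertex_tile V A M"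
      by (rule vertex_tile_cong[OF V(1)]) (use VM vV in blast)
    moreover have "critical_data V ?A {} i \<longleftrightarrow> critical_data V A M i" for i
    proof -
      have "?A = V \<longleftrightarrow> A = M" "A \<noteq> V" using VM vV 3(2) by auto
      then show ?thesis using 3(3) by (auto simp: critical_data_def)
    qed
    ultimately show ?thesis by (intro exI[of _ ?A] exI[of _ "{}"]) simp
  qed
qed

lemma critical_vertex_tile_iff:
  assumes "tile_data V A M"
  shows "critical_tile_of_index i (vertex_tile V A M) \<longleftrightarrow> critical_data V A M i"
  using vertex_tile_reduce[OF assms] critical_reduced_iff by metis

lemma vertex_tile_morse:
  assumes "tile_data V A M" "card V = n + 1"
  shows "\<exists>k \<mu>. morse_tile_on n k (convex hull V) \<mu> (vertex_tile V A M)"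
  using vertex_tile_reduce[OF assms(1)] assms(2) unfolding morse_tile_on_iff_vertex_tile by metis

lemma vertex_tile_basic:
  assumes "tile_data V A {}"
  shows "basic_tile (vertex_tile V A {})"
proof -
  have "V \<noteq> {}" "finite V" using assms aff_independent_finite by (auto simp: tile_data_def)
  then obtain n where "card V = n + 1" by (metis Suc_eq_plus1 card_0_eq not0_implies_Suc)
  moreover have "reduced_tile_data V A {}" using assms by (simp add: reduced_tile_data_def)
  ultimately have "morse_tile_on n (card A) (convex hull V) {} (vertex_tile V A {})"
    unfolding morse_tile_on_iff_vertex_tile by (metis convex_hull_empty)
  then show ?thesis unfolding basic_tile_def basic_tile_on_iff_morse by blast
qed

lemma vertex_tile_morse_data:
  assumes d: "tile_data V A M" and t: "morse_tile_on n k \<sigma> \<mu> (vertex_tile V A M)"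
  shows "card V = n + 1" "\<sigma> = convex hull V" "\<mu> = {} \<or> \<mu> = convex hull M"
proof -
  obtain A1 M1 where 1: "reduced_tile_data V A1 M1" "vertex_tile V A1 M1 = vertex_tile V A M"
      "M1 = {} \<or> M1 = M"
    using vertex_tile_reduce[OF d] by blast
  obtain V' A' M' where *: "reduced_tile_data V' A' M'" "card V' = n + 1"
       "\<sigma> = convex hull V'" "\<mu> = convex hull M'" "vertex_tile V A M = vertex_tile V' A' M'"
    using t unfolding morse_tile_on_iff_vertex_tile by metis
  have "V' = V" "M' = M1" using vertex_tile_unique[OF 1(1) *(1)] 1(2) *(5) by auto
  then show "card V = n + 1" "\<sigma> = convex hull V" "\<mu> = {} \<or> \<mu> = convex hull M"
    using 1(3) * by auto
qed

text \<open>The open simplex is treated like the other critical tiles by taking for \<open>B\<close> the set of all vertices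
but one.\<close>

lemma critical_tile_symmetric_data:
  assumes d: "reduced_tile_data V A M" and c: "critical_tile_of_index i (vertex_tile V A M)"
  shows "\<exists>B. tile_data V B B \<and> card B = i \<and> vertex_tile V B B = vertex_tile V A M"
proof -
  have V: "\<not> affine_dependent V" "A \<subseteq> V" "M \<subset> V" "M \<noteq> {} \<Longrightarrow> A \<subseteq> M"
    using d by (auto simp: reduced_tile_data_def tile_data_def)
  have fin: "finite V" using V(1) by (rule aff_independent_finite)
  consider "A = M" "i = card A" | "A = V" "i + 1 = card V"
    using c critical_reduced_iff[OF d] by (auto simp: critical_data_def)
  then show ?thesis
  proof cases
    case 1
    then show ?thesis using d by (auto simp: reduced_tile_data_def)
  next
    case 2
    then have M: "M = {}" using V by blast
    obtain v where v: "v \<in> V" using V(3) by blast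
    let ?B = "V - {v}"
    have "tile_data V ?B ?B" using V v by (auto simp: tile_data_def)
    moreover have "card ?B = i" using 2 v fin by simp
    moreover have "vertex_tile V ?B ?B = vertex_tile V A M"
      unfolding 2(1) M by (rule vertex_tile_cong[OF V(1)]) (use v in blast)
    ultimately show ?thesis by blast
  qed
qed

section \<open>The staircase triangulation of a product of simplices\<close>

definition affine_frame :: "nat \<Rightarrow> (nat \<Rightarrow> 'a::euclidean_space) \<Rightarrow> bool" where
  "affine_frame n v \<longleftrightarrow> inj_on v {..n} \<and> \<not> affine_dependent (v ` {..n})"

definition weights :: "nat \<Rightarrow> (nat \<Rightarrow> real) \<Rightarrow> bool" where
  "weights n b \<longleftrightarrow> (\<forall>i. 0 \<le> b i) \<and> (\<forall>i>n. b i = 0) \<and> (\<Sum>i\<le>n. b i) = 1"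

definition bary :: "nat \<Rightarrow> (nat \<Rightarrow> 'a::euclidean_space) \<Rightarrow> 'a \<Rightarrow> nat \<Rightarrow> real" where
  "bary n v x = (SOME b. weights n b \<and> (\<Sum>i\<le>n. b i *\<^sub>R v i) = x)"

lemma affine_frame_zero:
  assumes f: "affine_frame n v" and s: "(\<Sum>i\<le>n. c i) = 0" "(\<Sum>i\<le>n. c i *\<^sub>R v i) = 0" and i: "i \<le> n"
  shows "c i = 0"
proof (rule ccontr)
  assume ci: "c i \<noteq> 0"
  have inj: "inj_on v {..n}" using f by (simp add: affine_frame_def)
  define U where "U = c \<circ> the_inv_into {..n} v"
  have U: "U (v k) = c k" if "k \<le> n" for k
    using that inj by (simp add: U_def the_inv_into_f_f)
  have "sum U (v ` {..n}) = 0" "(\<Sum>x\<in>v ` {..n}. U x *\<^sub>R x) = 0"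
    using s U by (simp_all add: sum.reindex[OF inj])
  moreover have "U (v i) \<noteq> 0" using ci U i by simp
  ultimately have "affine_dependent (v ` {..n})"
    using i by (subst affine_dependent_explicit_finite) auto
  then show False using f by (simp add: affine_frame_def)
qed

lemma bary_exists:
  assumes f: "affine_frame n v" and x: "x \<in> convex hull (v ` {..n})"
  shows "\<exists>b. weights n b \<and> (\<Sum>i\<le>n. b i *\<^sub>R v i) = x"
proof -
  have inj: "inj_on v {..n}" using f by (simp add: affine_frame_def)
  obtain u where u: "\<forall>y\<in>v ` {..n}. 0 \<le> u y" "sum u (v ` {..n}) = 1"
      "(\<Sum>y\<in>v ` {..n}. u y *\<^sub>R y) = x"
    using x by (auto simp: convex_hull_finite)
  define b where "b i = (if i \<le> n then u (v i) else 0)" for i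
  have "weights n b" using u by (auto simp: weights_def b_def sum.reindex[OF inj])
  moreover have "(\<Sum>i\<le>n. b i *\<^sub>R v i) = x" using u by (auto simp: b_def sum.reindex[OF inj])
  ultimately show ?thesis by blast
qed

lemma bary_unique:
  assumes f: "affine_frame n v" and b: "weights n b" "(\<Sum>i\<le>n. b i *\<^sub>R v i) = x"
  shows "bary n v x = b"
proof -
  let ?c = "bary n v x"
  have c: "weights n ?c \<and> (\<Sum>i\<le>n. ?c i *\<^sub>R v i) = x"
    unfolding bary_def by (rule someI[of _ b]) (use b in simp)
  have "?c i - b i = 0" if "i \<le> n" for i
    using b c that by (intro affine_frame_zero[OF f, of "\<lambda>i. ?c i - b i"])
      (auto simp: weights_def sum_subtractf scaleR_diff_left)
  moreover have "?c i = b i" if "i > n" for i using b c that by (simp add: weights_def)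
  ultimately show ?thesis by (intro ext) (metis eq_iff_diff_eq_0 not_le)
qed

lemma bary:
  assumes "affine_frame n v" "x \<in> convex hull (v ` {..n})"
  shows "weights n (bary n v x)" "(\<Sum>i\<le>n. bary n v x i *\<^sub>R v i) = x"
  using bary_exists[OF assms] bary_unique[OF assms(1)] by auto

lemma combination_in_hull:
  fixes p :: "'i \<Rightarrow> 'c::real_vector"
  assumes "finite c" "\<And>q. q \<in> c \<Longrightarrow> 0 \<le> u q" "sum u c = 1"
  shows "(\<Sum>q\<in>c. u q *\<^sub>R p q) \<in> convex hull (p ` c)"
  by (rule convex_sum[OF assms(1) convex_convex_hull]) (use assms in \<open>auto intro: hull_inc\<close>)

lemma vertex_support_bary:
  assumes f: "affine_frame n v" and x: "x \<in> convex hull (v ` {..n})"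
  shows "vertex_support (v ` {..n}) x = v ` {i. bary n v x i \<noteq> 0}"
proof -
  have inj: "inj_on v {..n}" and ind: "\<not> affine_dependent (v ` {..n})"
    using f by (simp_all add: affine_frame_def)
  note b = bary[OF f x]
  have le: "i \<le> n" if "bary n v x i \<noteq> 0" for i using that b(1) by (meson not_le weights_def)
  have "x \<in> convex hull (v ` {..n} - {v i}) \<longleftrightarrow> bary n v x i = 0" if i: "i \<le> n" for i
  proof -
    have im: "v ` {..n} - {v i} = v ` ({..n} - {i})"
      using inj i by (auto simp: inj_on_def)
    show ?thesis
    proof
      assume "x \<in> convex hull (v ` {..n} - {v i})"
      then obtain u where u: "\<forall>y\<in>v ` ({..n} - {i}). 0 \<le> u y" "sum u (v ` ({..n} - {i})) = 1"
          "(\<Sum>y\<in>v ` ({..n} - {i}). u y *\<^sub>R y) = x"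
        unfolding im by (auto simp: convex_hull_finite)
      define c where "c k = (if k \<le> n \<and> k \<noteq> i then u (v k) else 0)" for k
      have inj': "inj_on v ({..n} - {i})" using inj by (rule inj_on_subset) auto
      have "(\<Sum>k\<le>n. c k) = (\<Sum>k\<in>{..n} - {i}. u (v k))"
        by (intro sum.mono_neutral_cong_right) (auto simp: c_def)
      moreover have "(\<Sum>k\<le>n. c k *\<^sub>R v k) = (\<Sum>k\<in>{..n} - {i}. u (v k) *\<^sub>R v k)"
        by (intro sum.mono_neutral_cong_right) (auto simp: c_def)
      ultimately have "weights n c" "(\<Sum>k\<le>n. c k *\<^sub>R v k) = x"
        using u by (auto simp: weights_def sum.reindex[OF inj'] c_def)
      then have "bary n v x = c" by (rule bary_unique[OF f])
      then show "bary n v x i = 0" by (simp add: c_def)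
    next
      assume z: "bary n v x i = 0"
      have "(\<Sum>k\<in>{..n} - {i}. bary n v x k) = 1"
        using b(1) z i by (simp add: weights_def sum_diff1)
      moreover have "(\<Sum>k\<in>{..n} - {i}. bary n v x k *\<^sub>R v k) = x"
        using b(2) z i by (simp add: sum_diff1)
      ultimately have "x \<in> convex hull (v ` ({..n} - {i}))"
        using combination_in_hull[of "{..n} - {i}" "bary n v x" v] b(1) by (auto simp: weights_def)
      then show "x \<in> convex hull (v ` {..n} - {v i})" by (simp add: im)
    qed
  qed
  then show ?thesis using le unfolding vertex_support_def by auto
qed

definition cum :: "(nat \<Rightarrow> real) \<Rightarrow> nat \<Rightarrow> real" where
  "cum b k = (\<Sum>i<k. b i)"

lemma cum_simps [simp]: "cum b 0 = 0" "cum b (Suc k) = cum b k + b k"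
  by (simp_all add: cum_def)

lemma cum_mono:
  assumes "weights n b" "k \<le> l"
  shows "cum b k \<le> cum b l"
  unfolding cum_def using assms by (intro sum_mono2) (auto simp: weights_def)

lemma cum_bounds:
  assumes "weights n b"
  shows "0 \<le> cum b k" "cum b k \<le> 1" "k > n \<Longrightarrow> cum b k = 1"
proof -
  show "0 \<le> cum b k" using cum_mono[OF assms, of 0 k] by simp
  show one: "cum b k = 1" if "k > n" for k
  proof -
    have "cum b k = (\<Sum>i\<le>n. b i)"
      unfolding cum_def by (intro sum.mono_neutral_right) (use that assms in \<open>auto simp: weights_def\<close>)
    then show ?thesis using assms by (simp add: weights_def)
  qed
  show "cum b k \<le> 1"
    using cum_mono[OF assms, of k "max k (Suc n)"] one[of "max k (Suc n)"] by simp
qed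

text \<open>Subdivide the unit interval into intervals of lengths \<open>b i\<close> and also into intervals of lengths
\<open>c j\<close>. Then this is the length of the intersection of the \<open>i\<close>-th with the \<open>j\<close>-th interval,
written as a second difference. These are the only non-negative weights on a chain of the grid with the
marginals \<open>b\<close> and \<open>c\<close>.\<close>

definition staircase_weight :: "(nat \<Rightarrow> real) \<Rightarrow> (nat \<Rightarrow> real) \<Rightarrow> nat \<times> nat \<Rightarrow> real" where
  "staircase_weight b c = (\<lambda>(i, j).
     min (cum b (Suc i)) (cum c (Suc j)) - min (cum b i) (cum c (Suc j))
     - min (cum b (Suc i)) (cum c j) + min (cum b i) (cum c j))"

definition comparable :: "nat \<times> nat \<Rightarrow> nat \<times> nat \<Rightarrow> bool" where
  "comparable q r \<longleftrightarrow> fst q \<le> fst r \<and> snd q \<le> snd r \<or> fst r \<le> fst q \<and> snd r \<le> snd q"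

definition grid_chains :: "nat \<Rightarrow> nat \<Rightarrow> (nat \<times> nat) set set" where
  "grid_chains n1 n2 = {c. c \<subseteq> {..n1} \<times> {..n2} \<and> (\<forall>q\<in>c. \<forall>r\<in>c. comparable q r)}"

lemma staircase_weight_nonneg:
  assumes "weights n1 b" "weights n2 c"
  shows "0 \<le> staircase_weight b c (i, j)"
proof -
  have "0 \<le> b i" "0 \<le> c j" using assms by (auto simp: weights_def)
  then show ?thesis by (auto simp: staircase_weight_def min_def)
qed

text \<open>A positive weight means that the intervals of \<open>i\<close> and \<open>j\<close> overlap; so the cells of positive
weight are passed in increasing order when one walks along the unit interval.\<close>

lemma staircase_weight_overlap:
  assumes "weights n1 b" "weights n2 c" "staircase_weight b c (i, j) \<noteq> 0"
  shows "cum b i < cum c (Suc j)" "cum c j < cum b (Suc i)"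
proof -
  have "0 \<le> b i" "0 \<le> c j" using assms by (auto simp: weights_def)
  then show "cum b i < cum c (Suc j)" "cum c j < cum b (Suc i)"
    using assms(3) by (auto simp: staircase_weight_def min_def split: if_splits)
qed

lemma staircase_weight_marginals:
  assumes b: "weights n1 b" and c: "weights n2 c"
  shows "(\<Sum>j\<le>n2. staircase_weight b c (i, j)) = b i"
    and "(\<Sum>i\<le>n1. staircase_weight b c (i, j)) = c j"
proof -
  \<comment> \<open>The sum over a column telescopes.\<close>
  define f where "f j = min (cum b (Suc i)) (cum c j) - min (cum b i) (cum c j)" for j
  have "(\<Sum>j\<le>n2. staircase_weight b c (i, j)) = (\<Sum>j<Suc n2. f (Suc j) - f j)"
    unfolding lessThan_Suc_atMost by (intro sum.cong) (auto simp: staircase_weight_def f_def)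
  also have "\<dots> = f (Suc n2) - f 0" by (rule sum_lessThan_telescope)
  also have "\<dots> = b i"
    using cum_bounds[OF b, of i] cum_bounds[OF b, of "Suc i"] cum_bounds(3)[OF c, of "Suc n2"]
    unfolding f_def by (simp add: min_def del: cum_simps(2)) (simp add: min_def)
  finally show "(\<Sum>j\<le>n2. staircase_weight b c (i, j)) = b i" .
next
  define f where "f i = min (cum b i) (cum c (Suc j)) - min (cum b i) (cum c j)" for i
  have "(\<Sum>i\<le>n1. staircase_weight b c (i, j)) = (\<Sum>i<Suc n1. f (Suc i) - f i)"
    unfolding lessThan_Suc_atMost by (intro sum.cong) (auto simp: staircase_weight_def f_def)
  also have "\<dots> = f (Suc n1) - f 0" by (rule sum_lessThan_telescope)
  also have "\<dots> = c j"
    using cum_bounds[OF c, of j] cum_bounds[OF c, of "Suc j"] cum_bounds(3)[OF b, of "Suc n1"]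
    unfolding f_def by (simp add: min_def del: cum_simps(2)) (simp add: min_def)
  finally show "(\<Sum>i\<le>n1. staircase_weight b c (i, j)) = c j" .
qed

lemma staircase_weight_chain:
  assumes b: "weights n1 b" and c: "weights n2 c"
  shows "{q. staircase_weight b c q \<noteq> 0} \<in> grid_chains n1 n2"
proof -
  have grid: "i \<le> n1 \<and> j \<le> n2" if z: "staircase_weight b c (i, j) \<noteq> 0" for i j
  proof (rule ccontr)
    assume "\<not> (i \<le> n1 \<and> j \<le> n2)"
    then show False
      using staircase_weight_overlap[OF b c z] cum_bounds[OF b] cum_bounds[OF c]
      by (smt (verit) not_le)
  qed
  have chain: "\<not> (i < i' \<and> j' < j)"
    if z: "staircase_weight b c (i, j) \<noteq> 0" "staircase_weight b c (i', j') \<noteq> 0" for i j i' j'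
  proof
    assume "i < i' \<and> j' < j"
    then have "cum b (Suc i) \<le> cum b i'" "cum c (Suc j') \<le> cum c j"
      using cum_mono[OF b, of "Suc i" i'] cum_mono[OF c, of "Suc j'" j] by (simp_all del: cum_simps)
    then show False
      using staircase_weight_overlap[OF b c z(1)] staircase_weight_overlap[OF b c z(2)]
      by (simp del: cum_simps)
  qed
  show ?thesis
    using grid chain unfolding grid_chains_def comparable_def by (fastforce simp: not_less not_le)
qed

text \<open>A chain cannot have an element above and left of the corner \<open>(k, l)\<close> and also one below and right
of it. So the elements left of the corner all lie below it, or the elements below it all lie left of
it.\<close>

lemma chain_partial_sums:
  fixes u :: "nat \<times> nat \<Rightarrow> real"
  assumes "{q. u q \<noteq> 0} \<in> grid_chains n1 n2"
  shows "(\<Sum>i<k. \<Sum>j<l. u (i, j)) = cum (\<lambda>i. \<Sum>j\<le>n2. u (i, j)) k \<or>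
         (\<Sum>i<k. \<Sum>j<l. u (i, j)) = cum (\<lambda>j. \<Sum>i\<le>n1. u (i, j)) l"
proof -
  have grid: "u (i, j) = 0" if "i > n1 \<or> j > n2" for i j
    using assms that by (fastforce simp: grid_chains_def)
  have chain: "comparable q r" if "u q \<noteq> 0" "u r \<noteq> 0" for q r
    using assms that unfolding grid_chains_def by blast
  consider "\<forall>i<k. \<forall>j\<ge>l. u (i, j) = 0" | "\<forall>i\<ge>k. \<forall>j<l. u (i, j) = 0"
    using chain by (fastforce simp: comparable_def)
  then show ?thesis
  proof cases
    case 1
    have "(\<Sum>j<l. u (i, j)) = (\<Sum>j\<le>n2. u (i, j))" if "i < k" for i
      by (intro sum.mono_neutral_cong) (use 1 grid that in auto)
    then show ?thesis by (simp add: cum_def)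
  next
    case 2
    have "(\<Sum>i<k. u (i, j)) = (\<Sum>i\<le>n1. u (i, j))" if "j < l" for j
      by (intro sum.mono_neutral_cong) (use 2 grid that in auto)
    moreover have "(\<Sum>i<k. \<Sum>j<l. u (i, j)) = (\<Sum>j<l. \<Sum>i<k. u (i, j))" by (rule sum.swap)
    ultimately show ?thesis by (simp add: cum_def)
  qed
qed

lemma second_difference:
  fixes u :: "nat \<times> nat \<Rightarrow> real"
  defines "U \<equiv> \<lambda>k l. \<Sum>i<k. \<Sum>j<l. u (i, j)"
  shows "u (i, j) = U (Suc i) (Suc j) - U i (Suc j) - U (Suc i) j + U i j"
  by (simp add: U_def)

text \<open>The partial sums of non-negative weights are bounded by those of both marginals, and by
\<open>chain_partial_sums\<close> one of the two bounds is attained. So the partial sums are the minima of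
those of the marginals.\<close>

lemma staircase_weight_unique:
  fixes u :: "nat \<times> nat \<Rightarrow> real"
  assumes ch: "{q. u q \<noteq> 0} \<in> grid_chains n1 n2" and nn: "\<And>q. 0 \<le> u q"
  shows "staircase_weight (\<lambda>i. \<Sum>j\<le>n2. u (i, j)) (\<lambda>j. \<Sum>i\<le>n1. u (i, j)) = u"
proof
  fix q :: "nat \<times> nat"
  obtain i j where q: "q = (i, j)" by (cases q)
  let ?b = "\<lambda>i. \<Sum>j\<le>n2. u (i, j)" and ?c = "\<lambda>j. \<Sum>i\<le>n1. u (i, j)"
  have grid: "u (i, j) = 0" if "i > n1 \<or> j > n2" for i j
    using ch that by (fastforce simp: grid_chains_def)
  have U: "(\<Sum>i<k. \<Sum>j<l. u (i, j)) = min (cum ?b k) (cum ?c l)" for k l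
  proof -
    have out: "i \<le> n1" "j \<le> n2" if "u (i, j) \<noteq> 0" for i j
      using grid that by (meson not_le)+
    have le1: "(\<Sum>j<l. u (i, j)) \<le> (\<Sum>j\<le>n2. u (i, j))" for i
    proof -
      have "(\<Sum>j<l. u (i, j)) = (\<Sum>j\<in>{..<l} \<inter> {..n2}. u (i, j))"
        by (intro sum.mono_neutral_right) (use out in auto)
      also have "\<dots> \<le> (\<Sum>j\<le>n2. u (i, j))" by (intro sum_mono2) (use nn in auto)
      finally show ?thesis .
    qed
    have le2: "(\<Sum>i<k. u (i, j)) \<le> (\<Sum>i\<le>n1. u (i, j))" for j
    proof -
      have "(\<Sum>i<k. u (i, j)) = (\<Sum>i\<in>{..<k} \<inter> {..n1}. u (i, j))"
        by (intro sum.mono_neutral_right) (use out in auto)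
      also have "\<dots> \<le> (\<Sum>i\<le>n1. u (i, j))" by (intro sum_mono2) (use nn in auto)
      finally show ?thesis .
    qed
    have "(\<Sum>i<k. \<Sum>j<l. u (i, j)) \<le> cum ?b k" unfolding cum_def by (intro sum_mono le1)
    moreover have "(\<Sum>i<k. \<Sum>j<l. u (i, j)) \<le> cum ?c l"
      unfolding cum_def by (subst sum.swap) (intro sum_mono le2)
    ultimately show ?thesis using chain_partial_sums[OF ch, where k = k and l = l] by auto
  qed
  show "staircase_weight ?b ?c q = u q"
    unfolding q using second_difference[of u i j] unfolding U
    by (simp add: staircase_weight_def)
qed

text \<open>The signed version of the preceding uniqueness, needed for affine independence.\<close>

lemma chain_zero:
  fixes u :: "nat \<times> nat \<Rightarrow> real"
  assumes ch: "{q. u q \<noteq> 0} \<in> grid_chains n1 n2"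
    and "\<And>i. i \<le> n1 \<Longrightarrow> (\<Sum>j\<le>n2. u (i, j)) = 0" "\<And>j. j \<le> n2 \<Longrightarrow> (\<Sum>i\<le>n1. u (i, j)) = 0"
  shows "u q = 0"
proof -
  have grid: "u (i, j) = 0" if "i > n1 \<or> j > n2" for i j
    using ch that by (fastforce simp: grid_chains_def)
  have "(\<Sum>j\<le>n2. u (i, j)) = 0" for i using assms(2)[of i] grid by (cases "i \<le> n1") auto
  moreover have "(\<Sum>i\<le>n1. u (i, j)) = 0" for j using assms(3)[of j] grid by (cases "j \<le> n2") auto
  ultimately have "(\<Sum>i<k. \<Sum>j<l. u (i, j)) = 0" for k l
    using chain_partial_sums[OF ch, where k = k and l = l] unfolding cum_def by simp
  then have "u (fst q, snd q) = 0" by (subst second_difference) (simp only: diff_self add_0)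
  then show ?thesis by simp
qed


text \<open>A finite abstract simplicial complex \<open>\<Delta>\<close> whose vertices are placed in space by \<open>p\<close> such that
the simplices fit together. The space is recorded by the support of its points, so that
intersections of simplices become intersections of sets.\<close>

locale geometric_realization =
  fixes \<Delta> :: "'i set set" and p :: "'i \<Rightarrow> 'c::euclidean_space" and Q :: "'c set"
    and supp :: "'c \<Rightarrow> 'i set"
  assumes finite_complex: "finite \<Delta>"
    and finite_face: "c \<in> \<Delta> \<Longrightarrow> finite c"
    and subface: "c \<in> \<Delta> \<Longrightarrow> d \<subseteq> c \<Longrightarrow> d \<in> \<Delta>"
    and inj_vertices: "inj_on p (\<Union>\<Delta>)"
    and independent: "c \<in> \<Delta> \<Longrightarrow> \<not> affine_dependent (p ` c)"
    and hull_iff: "c \<in> \<Delta> \<Longrightarrow> x \<in> convex hull (p ` c) \<longleftrightarrow> x \<in> Q \<and> supp x \<subseteq> c"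
    and supp_face: "x \<in> Q \<Longrightarrow> supp x \<in> \<Delta>"

definition grid_point :: "(nat \<Rightarrow> 'a) \<Rightarrow> (nat \<Rightarrow> 'b) \<Rightarrow> nat \<times> nat \<Rightarrow> 'a \<times> 'b" where
  "grid_point v w = map_prod v w"

definition staircase_support ::
    "nat \<Rightarrow> (nat \<Rightarrow> 'a::euclidean_space) \<Rightarrow> nat \<Rightarrow> (nat \<Rightarrow> 'b::euclidean_space) \<Rightarrow> 'a \<times> 'b \<Rightarrow> (nat \<times> nat) set"
  where "staircase_support n1 v n2 w x =
     {q. staircase_weight (bary n1 v (fst x)) (bary n2 w (snd x)) q \<noteq> 0}"

lemma grid_sum:
  fixes f :: "nat \<times> nat \<Rightarrow> 'c::comm_monoid_add"
  assumes "c \<subseteq> {..n1} \<times> {..n2}" "\<And>q. q \<notin> c \<Longrightarrow> f q = 0"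
  shows "(\<Sum>q\<in>c. f q) = (\<Sum>i\<le>n1. \<Sum>j\<le>n2. f (i, j))"
proof -
  have "(\<Sum>q\<in>c. f q) = (\<Sum>q\<in>{..n1} \<times> {..n2}. f q)"
    by (rule sum.mono_neutral_left) (use assms in auto)
  then show ?thesis by (simp add: sum.cartesian_product)
qed

lemma grid_combination:
  fixes v :: "nat \<Rightarrow> 'a::real_vector" and w :: "nat \<Rightarrow> 'b::real_vector"
  assumes "c \<subseteq> {..n1} \<times> {..n2}" "\<And>q. q \<notin> c \<Longrightarrow> u q = 0"
  shows "(\<Sum>q\<in>c. u q *\<^sub>R grid_point v w q) =
     (\<Sum>i\<le>n1. (\<Sum>j\<le>n2. u (i, j)) *\<^sub>R v i, \<Sum>j\<le>n2. (\<Sum>i\<le>n1. u (i, j)) *\<^sub>R w j)"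
proof (rule prod_eqI)
  have "fst (\<Sum>q\<in>c. u q *\<^sub>R grid_point v w q) = (\<Sum>q\<in>c. u q *\<^sub>R v (fst q))"
    by (simp add: fst_sum grid_point_def map_prod_def case_prod_beta)
  also have "\<dots> = (\<Sum>i\<le>n1. (\<Sum>j\<le>n2. u (i, j)) *\<^sub>R v i)"
    using assms by (subst grid_sum[of c n1 n2]) (auto simp: scaleR_sum_left)
  finally show "fst (\<Sum>q\<in>c. u q *\<^sub>R grid_point v w q) =
    fst (\<Sum>i\<le>n1. (\<Sum>j\<le>n2. u (i, j)) *\<^sub>R v i, \<Sum>j\<le>n2. (\<Sum>i\<le>n1. u (i, j)) *\<^sub>R w j)" by simp
  have "snd (\<Sum>q\<in>c. u q *\<^sub>R grid_point v w q) = (\<Sum>q\<in>c. u q *\<^sub>R w (snd q))"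
    by (simp add: snd_sum grid_point_def map_prod_def case_prod_beta)
  also have "\<dots> = (\<Sum>i\<le>n1. \<Sum>j\<le>n2. u (i, j) *\<^sub>R w j)"
    using assms by (subst grid_sum[of c n1 n2]) auto
  also have "\<dots> = (\<Sum>j\<le>n2. \<Sum>i\<le>n1. u (i, j) *\<^sub>R w j)" by (rule sum.swap)
  also have "\<dots> = (\<Sum>j\<le>n2. (\<Sum>i\<le>n1. u (i, j)) *\<^sub>R w j)" by (simp add: scaleR_sum_left)
  finally show "snd (\<Sum>q\<in>c. u q *\<^sub>R grid_point v w q) =
    snd (\<Sum>i\<le>n1. (\<Sum>j\<le>n2. u (i, j)) *\<^sub>R v i, \<Sum>j\<le>n2. (\<Sum>i\<le>n1. u (i, j)) *\<^sub>R w j)" by simp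
qed

lemma grid_chains_subset: "c \<in> grid_chains n1 n2 \<Longrightarrow> d \<subseteq> c \<Longrightarrow> d \<in> grid_chains n1 n2"
  unfolding grid_chains_def by blast

lemma finite_grid_chain: "c \<in> grid_chains n1 n2 \<Longrightarrow> finite c"
  unfolding grid_chains_def by (auto intro: finite_subset[of _ "{..n1} \<times> {..n2}"])

lemma inj_on_grid_point:
  assumes "affine_frame n1 v" "affine_frame n2 w"
  shows "inj_on (grid_point v w) ({..n1} \<times> {..n2})"
  using assms by (auto simp: grid_point_def affine_frame_def inj_on_def)

lemma staircase_independent:
  assumes v: "affine_frame n1 v" and w: "affine_frame n2 w" and c: "c \<in> grid_chains n1 n2"
  shows "\<not> affine_dependent (grid_point v w ` c)"
proof
  assume "affine_dependent (grid_point v w ` c)"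
  then obtain U where U: "sum U (grid_point v w ` c) = 0" "\<exists>y\<in>grid_point v w ` c. U y \<noteq> 0"
      "(\<Sum>y\<in>grid_point v w ` c. U y *\<^sub>R y) = 0"
    using finite_grid_chain[OF c] by (auto simp: affine_dependent_explicit_finite)
  have sub: "c \<subseteq> {..n1} \<times> {..n2}" using c by (simp add: grid_chains_def)
  have inj: "inj_on (grid_point v w) c" using inj_on_grid_point[OF v w] sub by (rule inj_on_subset)
  define u where "u q = (if q \<in> c then U (grid_point v w q) else 0)" for q
  have out: "q \<notin> c \<Longrightarrow> u q = 0" for q by (simp add: u_def)
  have s: "(\<Sum>q\<in>c. u q) = 0" "(\<Sum>q\<in>c. u q *\<^sub>R grid_point v w q) = 0"
    using U by (simp_all add: sum.reindex[OF inj] u_def)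
  have ch: "{q. u q \<noteq> 0} \<in> grid_chains n1 n2"
    by (rule grid_chains_subset[OF c]) (use out in blast)
  have tot: "(\<Sum>i\<le>n1. \<Sum>j\<le>n2. u (i, j)) = 0" using s(1) grid_sum[OF sub, of u] out by simp
  then have tot': "(\<Sum>j\<le>n2. \<Sum>i\<le>n1. u (i, j)) = 0" by (subst sum.swap)
  note comb = grid_combination[OF sub, of u v w, OF out, unfolded s(2)]
  have z1: "(\<Sum>i\<le>n1. (\<Sum>j\<le>n2. u (i, j)) *\<^sub>R v i) = 0"
    and z2: "(\<Sum>j\<le>n2. (\<Sum>i\<le>n1. u (i, j)) *\<^sub>R w j) = 0"
    using comb by (simp_all add: zero_prod_def)
  have "u q = 0" for q
    by (rule chain_zero[OF ch])
      (use affine_frame_zero[OF v tot z1] affine_frame_zero[OF w tot' z2] in auto)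
  then have "U (grid_point v w q) = 0" if "q \<in> c" for q using that unfolding u_def by metis
  then show False using U(2) by blast
qed

lemma staircase_hull_iff:
  assumes v: "affine_frame n1 v" and w: "affine_frame n2 w" and c: "c \<in> grid_chains n1 n2"
  shows "x \<in> convex hull (grid_point v w ` c) \<longleftrightarrow>
    x \<in> (convex hull (v ` {..n1})) \<times> (convex hull (w ` {..n2})) \<and> staircase_support n1 v n2 w x \<subseteq> c"
proof
  have sub: "c \<subseteq> {..n1} \<times> {..n2}" using c by (simp add: grid_chains_def)
  have inj: "inj_on (grid_point v w) c" using inj_on_grid_point[OF v w] sub by (rule inj_on_subset)
  assume "x \<in> convex hull (grid_point v w ` c)"
  then obtain U where U: "\<forall>y\<in>grid_point v w ` c. 0 \<le> U y" "sum U (grid_point v w ` c) = 1"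
      "(\<Sum>y\<in>grid_point v w ` c. U y *\<^sub>R y) = x"
    using finite_grid_chain[OF c] by (auto simp: convex_hull_finite)
  define u where "u q = (if q \<in> c then U (grid_point v w q) else 0)" for q
  have out: "q \<notin> c \<Longrightarrow> u q = 0" for q by (simp add: u_def)
  have nn: "0 \<le> u q" for q using U(1) by (simp add: u_def)
  have s: "(\<Sum>q\<in>c. u q) = 1" "(\<Sum>q\<in>c. u q *\<^sub>R grid_point v w q) = x"
    using U by (simp_all add: sum.reindex[OF inj] u_def)
  have ch: "{q. u q \<noteq> 0} \<in> grid_chains n1 n2"
    by (rule grid_chains_subset[OF c]) (use out in blast)
  have tot: "(\<Sum>i\<le>n1. \<Sum>j\<le>n2. u (i, j)) = 1" using s(1) grid_sum[OF sub, of u] out by simp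
  then have tot': "(\<Sum>j\<le>n2. \<Sum>i\<le>n1. u (i, j)) = 1" by (subst sum.swap)
  let ?b = "\<lambda>i. \<Sum>j\<le>n2. u (i, j)" and ?c = "\<lambda>j. \<Sum>i\<le>n1. u (i, j)"
  have grid: "u (i, j) = 0" if "i > n1 \<or> j > n2" for i j
    by (rule out) (use sub that in auto)
  have wt: "weights n1 ?b" "weights n2 ?c"
    using tot tot' grid by (auto simp: weights_def nn sum_nonneg)
  have comb: "(\<Sum>i\<le>n1. ?b i *\<^sub>R v i) = fst x" "(\<Sum>j\<le>n2. ?c j *\<^sub>R w j) = snd x"
    using grid_combination[OF sub, of u v w, OF out] s(2) by auto
  have "fst x \<in> convex hull (v ` {..n1})" "snd x \<in> convex hull (w ` {..n2})"
    using combination_in_hull[of "{..n1}" ?b v] combination_in_hull[of "{..n2}" ?c w] wt comb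
    by (auto simp: weights_def)
  moreover have "staircase_support n1 v n2 w x = {q. u q \<noteq> 0}"
    unfolding staircase_support_def bary_unique[OF v wt(1) comb(1)] bary_unique[OF w wt(2) comb(2)]
      staircase_weight_unique[OF ch nn] ..
  ultimately show "x \<in> (convex hull (v ` {..n1})) \<times> (convex hull (w ` {..n2})) \<and> staircase_support n1 v n2 w x \<subseteq> c"
    using out by (auto simp: mem_Times_iff)
next
  have sub: "c \<subseteq> {..n1} \<times> {..n2}" using c by (simp add: grid_chains_def)
  assume x: "x \<in> (convex hull (v ` {..n1})) \<times> (convex hull (w ` {..n2})) \<and> staircase_support n1 v n2 w x \<subseteq> c"
  then have xs: "fst x \<in> convex hull (v ` {..n1})" "snd x \<in> convex hull (w ` {..n2})" by auto
  note b1 = bary[OF v xs(1)] and b2 = bary[OF w xs(2)]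
  let ?u = "staircase_weight (bary n1 v (fst x)) (bary n2 w (snd x))"
  have out: "?u q = 0" if "q \<notin> c" for q using x that by (auto simp: staircase_support_def)
  note m = staircase_weight_marginals[OF b1(1) b2(1)]
  have "(\<Sum>q\<in>c. ?u q) = 1"
    using grid_sum[OF sub, of ?u] out m(1) b1(1) by (simp add: weights_def)
  moreover have "(\<Sum>q\<in>c. ?u q *\<^sub>R grid_point v w q) = x"
    using grid_combination[OF sub, of ?u v w] out m b1(2) b2(2) by simp
  moreover have "0 \<le> ?u q" for q
    using staircase_weight_nonneg[OF b1(1) b2(1)] by (cases q) simp
  ultimately show "x \<in> convex hull (grid_point v w ` c)"
    using combination_in_hull[of c ?u "grid_point v w"] finite_grid_chain[OF c] by simp
qed

lemma staircase_realization:
  assumes v: "affine_frame n1 v" and w: "affine_frame n2 w"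
  shows "geometric_realization (grid_chains n1 n2) (grid_point v w)
    ((convex hull (v ` {..n1})) \<times> (convex hull (w ` {..n2}))) (staircase_support n1 v n2 w)"
proof
  show "finite (grid_chains n1 n2)"
    by (rule finite_subset[of _ "Pow ({..n1} \<times> {..n2})"]) (auto simp: grid_chains_def)
  show "inj_on (grid_point v w) (\<Union>(grid_chains n1 n2))"
    by (rule inj_on_subset[OF inj_on_grid_point[OF v w]]) (auto simp: grid_chains_def)
  show "staircase_support n1 v n2 w x \<in> grid_chains n1 n2"
    if "x \<in> (convex hull (v ` {..n1})) \<times> (convex hull (w ` {..n2}))" for x
    using that bary(1)[OF v] bary(1)[OF w] unfolding staircase_support_def
    by (intro staircase_weight_chain) auto
qed (use finite_grid_chain grid_chains_subset staircase_independent[OF v w]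
      staircase_hull_iff[OF v w] in blast)+

text \<open>The supports in the two factors are the projections of the support in the product; hence the product
of two tiles is a union of open simplices.\<close>

lemma staircase_support_projections:
  assumes v: "affine_frame n1 v" and w: "affine_frame n2 w"
    and x: "x \<in> convex hull (v ` {..n1})" and y: "y \<in> convex hull (w ` {..n2})"
  shows "fst ` staircase_support n1 v n2 w (x, y) = {i. bary n1 v x i \<noteq> 0}"
    and "snd ` staircase_support n1 v n2 w (x, y) = {j. bary n2 w y j \<noteq> 0}"
proof -
  note b1 = bary[OF v x] and b2 = bary[OF w y]
  let ?u = "staircase_weight (bary n1 v x) (bary n2 w y)"
  note m = staircase_weight_marginals[OF b1(1) b2(1)]
  note nn = staircase_weight_nonneg[OF b1(1) b2(1)]
  have grid: "i \<le> n1" "j \<le> n2" if "?u (i, j) \<noteq> 0" for i j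
    using staircase_weight_chain[OF b1(1) b2(1)] that by (auto simp: grid_chains_def)
  have "bary n1 v x i \<noteq> 0 \<longleftrightarrow> (\<exists>j\<le>n2. ?u (i, j) \<noteq> 0)" for i
    unfolding m(1)[of i, symmetric] using nn by (subst sum_nonneg_eq_0_iff) auto
  then show "fst ` staircase_support n1 v n2 w (x, y) = {i. bary n1 v x i \<noteq> 0}"
    using grid by (force simp: staircase_support_def image_iff)
  have "bary n2 w y j \<noteq> 0 \<longleftrightarrow> (\<exists>i\<le>n1. ?u (i, j) \<noteq> 0)" for j
    unfolding m(2)[of j, symmetric] using nn by (subst sum_nonneg_eq_0_iff) auto
  then show "snd ` staircase_support n1 v n2 w (x, y) = {j. bary n2 w y j \<noteq> 0}"
    using grid by (force simp: staircase_support_def image_iff)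
qed

section \<open>Lattice paths\<close>

text \<open>A path is encoded by its heights: \<open>h i\<close> is the height at which it enters the column \<open>i\<close> and
\<open>h (Suc i)\<close> the height at which it leaves it. It ends at the point \<open>(n1, n2)\<close>, hence the
value \<open>n2\<close> at \<open>Suc n1\<close>; the values beyond make the encoding unique.\<close>

definition lattice_paths :: "nat \<Rightarrow> nat \<Rightarrow> (nat \<Rightarrow> nat) set" where
  "lattice_paths n1 n2 = {h. h 0 = 0 \<and> (\<forall>i\<le>n1. h i \<le> h (Suc i)) \<and> (\<forall>i>n1. h i = n2)}"

definition path_cells :: "nat \<Rightarrow> (nat \<Rightarrow> nat) \<Rightarrow> (nat \<times> nat) set" where
  "path_cells n1 h = {(i, j). i \<le> n1 \<and> h i \<le> j \<and> j \<le> h (Suc i)}"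

text \<open>The cells where the path turns from up to right. Lowering the path at such a cell gives the adjacent
earlier path.\<close>

definition corners :: "nat \<Rightarrow> (nat \<Rightarrow> nat) \<Rightarrow> (nat \<times> nat) set" where
  "corners n1 h = {(i, j). i < n1 \<and> h i < h (Suc i) \<and> j = h (Suc i)}"

text \<open>The cells that a new chain of the path has to contain: the corners, and the prescribed columns and
rows that consist of one cell.\<close>

definition restriction :: "nat \<Rightarrow> nat \<Rightarrow> nat \<Rightarrow> (nat \<Rightarrow> nat) \<Rightarrow> (nat \<times> nat) set" where
  "restriction n1 a1 a2 h = corners n1 h
     \<union> {(i, j) \<in> path_cells n1 h. i < a1 \<and> h i = h (Suc i)}
     \<union> {(i, j) \<in> path_cells n1 h. j < a2 \<and> (\<forall>k. (k, j) \<in> path_cells n1 h \<longrightarrow> k = i)}"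

text \<open>As \<open>path_cells n1 h\<close> is a chain, its parts in the first \<open>m1\<close> columns and in the first \<open>m2\<close>
rows are nested. This is their union, hence the larger of them.\<close>

definition early_cells :: "nat \<Rightarrow> nat \<Rightarrow> nat \<Rightarrow> (nat \<Rightarrow> nat) \<Rightarrow> (nat \<times> nat) set" where
  "early_cells n1 m1 m2 h = {q \<in> path_cells n1 h. fst q < m1 \<or> snd q < m2}"

lemma path_mono:
  assumes h: "h \<in> lattice_paths n1 n2" and "i \<le> k"
  shows "h i \<le> h k"
proof -
  have "h i \<le> h (Suc i)" for i
    using h by (cases "i \<le> n1") (auto simp: lattice_paths_def)
  then show ?thesis using \<open>i \<le> k\<close> by (rule lift_Suc_mono_le)
qed

lemma path_bound:
  assumes h: "h \<in> lattice_paths n1 n2"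
  shows "h i \<le> n2"
  using path_mono[OF h, of i "max i (Suc n1)"] h by (auto simp: lattice_paths_def)

lemma finite_lattice_paths: "finite (lattice_paths n1 n2)"
proof (rule finite_subset)
  show "lattice_paths n1 n2 \<subseteq>
      {h. \<forall>i. (i \<in> {..n1} \<longrightarrow> h i \<in> {..n2}) \<and> (i \<notin> {..n1} \<longrightarrow> h i = n2)}"
    using path_bound by (auto simp: lattice_paths_def)
qed (rule finite_set_of_finite_funs; simp)

lemma grid_chainI:
  assumes "\<And>i j. (i, j) \<in> c \<Longrightarrow> i \<le> n1" "\<And>i j. (i, j) \<in> c \<Longrightarrow> j \<le> n2"
    and "\<And>i j i' j'. (i, j) \<in> c \<Longrightarrow> (i', j') \<in> c \<Longrightarrow> \<not> (i < i' \<and> j' < j)"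
  shows "c \<in> grid_chains n1 n2"
proof -
  have "comparable q r" if "q \<in> c" "r \<in> c" for q r
    using assms(3)[of "fst q" "snd q" "fst r" "snd r"] assms(3)[of "fst r" "snd r" "fst q" "snd q"] that
    unfolding comparable_def by (simp add: not_less) linarith
  then show ?thesis using assms(1,2) unfolding grid_chains_def by auto
qed

lemma path_cells_chain:
  assumes h: "h \<in> lattice_paths n1 n2"
  shows "path_cells n1 h \<in> grid_chains n1 n2"
proof -
  have "\<not> (i < i' \<and> j' < j)" if "(i, j) \<in> path_cells n1 h" "(i', j') \<in> path_cells n1 h" for i j i' j'
  proof
    assume "i < i' \<and> j' < j"
    then have "h (Suc i) \<le> h i'" "j' < j" using path_mono[OF h, of "Suc i" i'] by auto
    then show False using that by (auto simp: path_cells_def)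
  qed
  moreover have "j \<le> n2" if "(i, j) \<in> path_cells n1 h" for i j
    using that path_bound[OF h, of "Suc i"] by (auto simp: path_cells_def)
  moreover have "i \<le> n1" if "(i, j) \<in> path_cells n1 h" for i j
    using that by (simp add: path_cells_def)
  ultimately show ?thesis by (intro grid_chainI) blast+
qed

lemma card_path_cells:
  assumes h: "h \<in> lattice_paths n1 n2"
  shows "card (path_cells n1 h) = n1 + n2 + 1"
proof -
  have step: "h i \<le> h (Suc i)" for i using path_mono[OF h] by simp
  have "card (Sigma {..k} (\<lambda>i. {h i..h (Suc i)})) = k + h (Suc k) + 1" for k
  proof (induction k)
    case 0
    then show ?case using h by (simp add: lattice_paths_def)
  next
    case (Suc k)
    then show ?case using step[of "Suc k"] by simp
  qed
  moreover have "path_cells n1 h = Sigma {..n1} (\<lambda>i. {h i..h (Suc i)})"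
    by (auto simp: path_cells_def)
  ultimately show ?thesis using h by (simp add: lattice_paths_def)
qed

text \<open>A path through \<open>c\<close> has to reach in each column at least the height of the elements of \<open>c\<close> in
this column and in the columns before; nothing else is required before the last column.\<close>

definition lowest_path :: "nat \<Rightarrow> nat \<Rightarrow> (nat \<times> nat) set \<Rightarrow> nat \<Rightarrow> nat" where
  "lowest_path n1 n2 c i = (if i > n1 then n2 else Max (insert 0 (snd ` {q \<in> c. fst q < i})))"

text \<open>A path through \<open>c\<close> has to reach in each column at least the height of the elements of \<open>c\<close> in
this column and in the columns before; nothing else is required before the last column.\<close>

lemma lowest_path:
  assumes c: "c \<in> grid_chains n1 n2"
  shows "lowest_path n1 n2 c \<in> lattice_paths n1 n2"
    and "c \<subseteq> path_cells n1 (lowest_path n1 n2 c)"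
    and "corners n1 (lowest_path n1 n2 c) \<subseteq> c"
proof -
  let ?h = "lowest_path n1 n2 c"
  have fin: "finite (insert 0 (snd ` {q \<in> c. fst q < i}))" for i
    using finite_grid_chain[OF c] by simp
  have sub: "fst q \<le> n1" "snd q \<le> n2" if "q \<in> c" for q
    using c that by (auto simp: grid_chains_def)
  have le: "?h i \<le> n2" for i using fin sub by (auto simp: lowest_path_def)
  have ge: "snd q \<le> ?h i" if "q \<in> c" "fst q < i" for q i
    using that fin sub(2) by (auto simp: lowest_path_def intro!: Max_ge)
  have mono: "?h i \<le> ?h (Suc i)" for i
  proof (cases "Suc i > n1")
    case True
    then have "?h (Suc i) = n2" by (simp add: lowest_path_def)
    then show ?thesis using le by simp
  next
    case False
    then show ?thesis using fin by (auto simp: lowest_path_def intro!: Max_mono)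
  qed
  moreover have "?h 0 = 0" "\<And>i. i > n1 \<Longrightarrow> ?h i = n2" by (auto simp: lowest_path_def)
  ultimately show "?h \<in> lattice_paths n1 n2" unfolding lattice_paths_def by blast
  have bot: "?h i \<le> j" if q: "(i, j) \<in> c" for i j
  proof -
    have "i \<le> n1" using sub[OF q] by simp
    moreover have "snd r \<le> j" if "r \<in> c" "fst r < i" for r
      using c that q by (fastforce simp: grid_chains_def comparable_def)
    ultimately show ?thesis using fin by (auto simp: lowest_path_def)
  qed
  show "c \<subseteq> path_cells n1 ?h"
    using bot ge sub by (fastforce simp: path_cells_def)
  show "corners n1 ?h \<subseteq> c"
  proof
    fix q assume "q \<in> corners n1 ?h"
    then obtain i where i: "i < n1" "?h i < ?h (Suc i)" "q = (i, ?h (Suc i))"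
      by (auto simp: corners_def)
    have "?h (Suc i) = Max (insert 0 (snd ` {q \<in> c. fst q < Suc i}))"
      using i by (simp add: lowest_path_def)
    then have "?h (Suc i) \<in> insert 0 (snd ` {q \<in> c. fst q < Suc i})"
      using fin Max_in by (metis insert_not_empty)
    then obtain r where r: "r \<in> c" "fst r < Suc i" "snd r = ?h (Suc i)" using i(2) by auto
    moreover have "\<not> fst r < i" using ge[OF r(1), of i] r(3) i(2) by auto
    ultimately have "r = q" using i(3) by (auto simp: prod_eq_iff)
    then show "q \<in> c" using r by simp
  qed
qed

text \<open>A path rises only in order to reach a corner, so every path through its corners is at least as high.\<close>

lemma corners_minimal:
  assumes h: "h \<in> lattice_paths n1 n2" and h': "h' \<in> lattice_paths n1 n2"
    and "corners n1 h \<subseteq> path_cells n1 h'"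
  shows "h i \<le> h' i"
proof (induction i)
  case 0
  then show ?case using h by (simp add: lattice_paths_def)
next
  case (Suc i)
  consider "i \<ge> n1" | "h (Suc i) = h i" | "i < n1" "h i < h (Suc i)"
    using path_mono[OF h, of i "Suc i"] by linarith
  then show ?case
  proof cases
    case 1
    then show ?thesis using h h' by (simp add: lattice_paths_def)
  next
    case 2
    then show ?thesis using Suc path_mono[OF h', of i "Suc i"] by simp
  next
    case 3
    then have "(i, h (Suc i)) \<in> path_cells n1 h'" using assms(3) by (auto simp: corners_def)
    then show ?thesis by (simp add: path_cells_def)
  qed
qed

lemma path_height_less:
  assumes h: "h \<in> lattice_paths n1 n2" and h': "h' \<in> lattice_paths n1 n2"
    and "\<And>i. h i \<le> h' i"
  shows "h = h' \<or> (\<Sum>i\<le>n1. h i) < (\<Sum>i\<le>n1. h' i)"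
proof (rule disjCI)
  assume "\<not> (\<Sum>i\<le>n1. h i) < (\<Sum>i\<le>n1. h' i)"
  then have eq: "(\<Sum>i\<le>n1. h i) = (\<Sum>i\<le>n1. h' i)"
    using sum_mono[of "{..n1}" h h'] assms(3) by (meson antisym not_less)
  have "h i = h' i" for i
  proof (cases "i \<le> n1")
    case True
    then show ?thesis using sum_mono_inv[OF eq assms(3)] by auto
  next
    case False
    then show ?thesis using h h' by (simp add: lattice_paths_def)
  qed
  then show "h = h'" by blast
qed

lemma restriction_subset:
  assumes h: "h \<in> lattice_paths n1 n2"
  shows "restriction n1 a1 a2 h \<subseteq> path_cells n1 h"
  by (auto simp: restriction_def corners_def path_cells_def)

text \<open>A prescribed column with several cells ends in a corner unless it is the last one, which is excluded
by \<open>a1 \<le> n1\<close>. A row with several cells is entered from below, and starts with a corner, unless it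
is the row 0. In that case the column 0 consists of one cell and belongs to the restriction.\<close>

lemma restriction_iff:
  assumes h: "h \<in> lattice_paths n1 n2" and c: "c \<subseteq> path_cells n1 h"
    and a1: "a1 \<le> n1" and a2: "a2 \<le> Suc n2" "a2 = 0 \<or> 1 \<le> a1"
  shows "restriction n1 a1 a2 h \<subseteq> c \<longleftrightarrow>
    corners n1 h \<subseteq> c \<and> {..<a1} \<subseteq> fst ` c \<and> {..<a2} \<subseteq> snd ` c"
proof
  assume r: "restriction n1 a1 a2 h \<subseteq> c"
  then have co: "corners n1 h \<subseteq> c" by (auto simp: restriction_def)
  have col: "i \<in> fst ` c" if i: "i < a1" for i
  proof (cases "h i = h (Suc i)")
    case True
    then have "(i, h i) \<in> restriction n1 a1 a2 h"
      using i a1 by (auto simp: restriction_def path_cells_def)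
    then show ?thesis using r by force
  next
    case False
    then have "(i, h (Suc i)) \<in> corners n1 h"
      using i a1 path_mono[OF h, of i "Suc i"] by (auto simp: corners_def)
    then show ?thesis using co by force
  qed
  have row: "j \<in> snd ` c" if j: "j < a2" for j
  proof -
    \<comment> \<open>The column in which the path enters the row \<open>j\<close>.\<close>
    define i where "i = (LEAST i. j \<le> h (Suc i))"
    have ex: "j \<le> h (Suc n1)" using j a2 h by (simp add: lattice_paths_def)
    have ji: "j \<le> h (Suc i)" unfolding i_def by (rule LeastI[of _ n1]) (rule ex)
    have in1: "i \<le> n1" unfolding i_def by (rule Least_le) (rule ex)
    have least: "i \<le> k" if "j \<le> h (Suc k)" for k unfolding i_def using that by (rule Least_le)
    have low: "h i < j \<or> i = 0 \<and> h i \<le> j"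
    proof (cases i)
      case 0
      then show ?thesis using h by (simp add: lattice_paths_def)
    next
      case (Suc k)
      then show ?thesis using least[of k] not_le by auto
    qed
    then have ij: "(i, j) \<in> path_cells n1 h" using ji in1 by (auto simp: path_cells_def)
    show ?thesis
    proof (cases "\<forall>k. (k, j) \<in> path_cells n1 h \<longrightarrow> k = i")
      case True
      then have "(i, j) \<in> restriction n1 a1 a2 h" using ij j unfolding restriction_def by blast
      then show ?thesis using r by force
    next
      case False
      then obtain k where k: "(k, j) \<in> path_cells n1 h" "k \<noteq> i" by blast
      then have ki: "i < k" using least[of k] by (simp add: path_cells_def)
      have hj: "h (Suc i) = j" and "i < n1"
        using k ki ji path_mono[OF h, of "Suc i" k] by (auto simp: path_cells_def)
      show ?thesis
      proof (cases "h i < j")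
        case True
        then have "(i, j) \<in> corners n1 h" using hj \<open>i < n1\<close> by (auto simp: corners_def)
        then show ?thesis using co by force
      next
        case False
        then have "i = 0" "h 0 = h (Suc 0)" using low hj by auto
        then have "(0, j) \<in> restriction n1 a1 a2 h"
          using ij j a2(2) by (auto simp: restriction_def)
        then show ?thesis using r by force
      qed
    qed
  qed
  show "corners n1 h \<subseteq> c \<and> {..<a1} \<subseteq> fst ` c \<and> {..<a2} \<subseteq> snd ` c"
    using co col row by auto
next
  assume r: "corners n1 h \<subseteq> c \<and> {..<a1} \<subseteq> fst ` c \<and> {..<a2} \<subseteq> snd ` c"
  have "(i, j) \<in> c" if ij: "(i, j) \<in> restriction n1 a1 a2 h" for i j
  proof -
    consider "(i, j) \<in> corners n1 h"
      | "(i, j) \<in> path_cells n1 h" "i < a1" "h i = h (Suc i)"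
      | "j < a2" "\<And>k. (k, j) \<in> path_cells n1 h \<Longrightarrow> k = i"
      using ij unfolding restriction_def by blast
    then show ?thesis
    proof cases
      case 1
      then show ?thesis using r by blast
    next
      case 2
      then obtain k where k: "(i, k) \<in> c" using r by force
      then have "(i, k) \<in> path_cells n1 h" using c by blast
      then have "k = j" using 2(1,3) by (auto simp: path_cells_def)
      then show ?thesis using k by simp
    next
      case 3
      then obtain k where k: "(k, j) \<in> c" using r by force
      then show ?thesis using 3 c by blast
    qed
  qed
  then show "restriction n1 a1 a2 h \<subseteq> c" by auto
qed

lemma early_cells_iff:
  assumes h: "h \<in> lattice_paths n1 n2" and c: "c \<subseteq> path_cells n1 h"
  shows "c \<subseteq> early_cells n1 m1 m2 h \<longleftrightarrow> fst ` c \<subseteq> {..<m1} \<or> snd ` c \<subseteq> {..<m2}"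
proof
  assume D: "c \<subseteq> early_cells n1 m1 m2 h"
  show "fst ` c \<subseteq> {..<m1} \<or> snd ` c \<subseteq> {..<m2}"
  proof (rule ccontr)
    assume "\<not> (fst ` c \<subseteq> {..<m1} \<or> snd ` c \<subseteq> {..<m2})"
    then obtain q r where qr: "q \<in> c" "\<not> fst q < m1" "r \<in> c" "\<not> snd r < m2" by auto
    then have "snd q < m2" "fst r < m1" using D by (auto simp: early_cells_def)
    moreover have "comparable q r"
      using qr c path_cells_chain[OF h] unfolding grid_chains_def by blast
    ultimately show False using qr by (auto simp: comparable_def)
  qed
next
  assume "fst ` c \<subseteq> {..<m1} \<or> snd ` c \<subseteq> {..<m2}"
  then have *: "fst q < m1 \<or> snd q < m2" if "q \<in> c" for q using that by auto
  show "c \<subseteq> early_cells n1 m1 m2 h"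
  proof
    fix q assume q: "q \<in> c"
    then show "q \<in> early_cells n1 m1 m2 h"
      using *[OF q] c unfolding early_cells_def by (cases q) auto
  qed
qed

lemma early_cells_initial:
  assumes h: "h \<in> lattice_paths n1 n2"
    and "q \<in> early_cells n1 m1 m2 h" "r \<in> path_cells n1 h" "r \<notin> early_cells n1 m1 m2 h"
  shows "fst q \<le> fst r \<and> snd q \<le> snd r"
proof -
  have "q \<in> path_cells n1 h" using assms(2) by (simp add: early_cells_def)
  then have "comparable q r" using assms(3) path_cells_chain[OF h] unfolding grid_chains_def by blast
  moreover have "fst q < m1 \<or> snd q < m2" "\<not> fst r < m1" "\<not> snd r < m2"
    using assms(2-4) by (simp_all add: early_cells_def)
  ultimately show ?thesis unfolding comparable_def by linarith
qed

lemma early_cells_psubset: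
  assumes h: "h \<in> lattice_paths n1 n2" and m: "m1 \<le> n1" "m2 \<le> n2"
  shows "early_cells n1 m1 m2 h \<subset> path_cells n1 h"
proof -
  have "h (Suc n1) = n2" using h by (simp add: lattice_paths_def)
  then have "(n1, n2) \<in> path_cells n1 h" using path_bound[OF h, of n1] by (simp add: path_cells_def)
  moreover have "(n1, n2) \<notin> early_cells n1 m1 m2 h" using m by (simp add: early_cells_def)
  moreover have "early_cells n1 m1 m2 h \<subseteq> path_cells n1 h" by (auto simp: early_cells_def)
  ultimately show ?thesis by blast
qed

lemma restriction_nonempty:
  assumes h: "h \<in> lattice_paths n1 n2" and a: "1 \<le> a1" "a1 \<le> n1" "a2 \<le> Suc n2"
  shows "restriction n1 a1 a2 h \<noteq> {}"
proof -
  have "{..<a1} \<subseteq> fst ` restriction n1 a1 a2 h"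
    using restriction_iff[OF h restriction_subset[OF h] a(2,3), of a1 a2] a(1) by simp
  moreover have "0 \<in> {..<a1}" using a(1) by simp
  ultimately show ?thesis by blast
qed

text \<open>The cell \<open>(n1, n2)\<close> can belong to the restriction only because its row is prescribed, and then
\<open>n1\<close> is positive and the path enters the last column at a lower cell. It turns there from right to
up, so that this cell is not in the restriction.\<close>

lemma restriction_proper:
  assumes h: "h \<in> lattice_paths n1 n2" and a: "a1 \<le> n1" and n: "1 \<le> n1 \<or> a2 \<le> n2"
  shows "restriction n1 a1 a2 h \<noteq> path_cells n1 h"
proof
  assume eq: "restriction n1 a1 a2 h = path_cells n1 h"
  have hs: "h (Suc n1) = n2" using h by (simp add: lattice_paths_def)
  have bound: "h n1 \<le> n2" using path_bound[OF h] .
  have mem: "(n1, j) \<in> path_cells n1 h \<Longrightarrow> \<not> (\<exists>k<n1. (k, j) \<in> path_cells n1 h) \<and> j < a2" for j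
  proof -
    assume "(n1, j) \<in> path_cells n1 h"
    then have "(n1, j) \<in> restriction n1 a1 a2 h" using eq by simp
    then show "\<not> (\<exists>k<n1. (k, j) \<in> path_cells n1 h) \<and> j < a2"
      using a by (auto simp: restriction_def corners_def)
  qed
  have "(n1, n2) \<in> path_cells n1 h" "(n1, h n1) \<in> path_cells n1 h"
    using hs bound by (auto simp: path_cells_def)
  note m = mem[OF this(1)] mem[OF this(2)]
  then have "n2 < a2" by simp
  then have "1 \<le> n1" using n by simp
  then have "(n1 - 1, h n1) \<in> path_cells n1 h"
    using path_mono[OF h, of "n1 - 1" n1] by (auto simp: path_cells_def)
  then show False using m(2) \<open>1 \<le> n1\<close> by (metis diff_less less_le_trans zero_less_one)
qed

text \<open>A path that leaves the column 0 at a height below \<open>m2\<close> runs into cells that are early, but neither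
corners nor alone in their row. They can only be in the restriction as one-cell columns, so the path
stays at the same height until the last column, which is not prescribed.\<close>

lemma flat_row_contradiction:
  assumes h: "h \<in> lattice_paths n1 n2" and n1: "1 \<le> n1" and a: "a1 \<le> n1" and low: "h 1 < m2"
    and sub: "early_cells n1 m1 m2 h \<subseteq> restriction n1 a1 a2 h"
  shows False
proof -
  have cell: "(i, h 1) \<in> path_cells n1 h" if "1 \<le> i" "i \<le> n1" "h i = h 1" for i
    using that path_mono[OF h, of i "Suc i"] by (auto simp: path_cells_def)
  have cell0: "(0, h 1) \<in> path_cells n1 h" using h by (auto simp: path_cells_def lattice_paths_def)
  have step: "i < a1 \<and> h (Suc i) = h 1" if i: "1 \<le> i" "i \<le> n1" "h i = h 1" for i
  proof -
    have "(i, h 1) \<in> restriction n1 a1 a2 h"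
      using sub cell[OF i] low by (auto simp: early_cells_def)
    then show ?thesis using i cell0 by (auto simp: restriction_def corners_def)
  qed
  have "h (Suc i) = h 1" if "i < n1" for i
    using that
  proof (induction i)
    case (Suc i)
    then show ?case using step[of "Suc i"] by auto
  qed simp
  then have "h n1 = h 1" using n1 by (metis Suc_diff_1 diff_less less_le_trans zero_less_one order_refl less_numeral_extra(1) One_nat_def Suc_le_eq)
  then show False using step[of n1] n1 a by auto
qed

text \<open>If \<open>m1\<close> is positive, then the column \<open>m1 - 1\<close> is not prescribed, and the cell where the path
enters it is early but not in the restriction. Otherwise, if \<open>m2\<close> is positive, the path has to leave the column 0 at a
corner above the first \<open>m2\<close> rows, which is in the restriction but not early; and if \<open>m2\<close> is zero,
there are no early cells, while the prescribed column 0 makes the restriction non-empty.\<close>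

lemma restriction_noncritical:
  assumes h: "h \<in> lattice_paths n1 n2" and a: "1 \<le> a1" "a1 \<le> n1" "a2 \<le> Suc n2"
    and m: "m1 = 0 \<or> a1 < m1 \<and> m1 \<le> n1"
  shows "restriction n1 a1 a2 h \<noteq> early_cells n1 m1 m2 h"
proof
  assume eq: "restriction n1 a1 a2 h = early_cells n1 m1 m2 h"
  show False
  proof (cases "m1 = 0")
    case False
    then obtain k where k: "m1 = Suc (Suc k)" "a1 \<le> Suc k" "Suc k \<le> n1"
      using m a by (metis Suc_le_D Suc_le_eq One_nat_def less_Suc_eq_le le_SucI le_trans Suc_leD)
    have "(Suc k, h (Suc k)) \<in> path_cells n1 h" "(k, h (Suc k)) \<in> path_cells n1 h"
      using k path_mono[OF h, of "Suc k" "Suc (Suc k)"] path_mono[OF h, of k "Suc k"]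
      by (auto simp: path_cells_def)
    moreover from this have "(Suc k, h (Suc k)) \<in> restriction n1 a1 a2 h"
      using k by (simp add: eq early_cells_def)
    ultimately show False using k by (auto simp: restriction_def corners_def)
  next
    case True
    have "early_cells n1 m1 m2 h \<noteq> {}" using restriction_nonempty[OF h a] eq by simp
    then have "0 < m2" using True by (auto simp: early_cells_def)
    have "m2 \<le> h 1"
      using flat_row_contradiction[OF h _ a(2), of m2 m1 a2] eq a by fastforce
    moreover have "h 0 = 0" using h by (simp add: lattice_paths_def)
    ultimately have "(0, h 1) \<in> restriction n1 a1 a2 h"
      using \<open>0 < m2\<close> a by (auto simp: restriction_def corners_def)
    then show False using eq True \<open>m2 \<le> h 1\<close> by (auto simp: early_cells_def)
  qed
qed

text \<open>Up to height \<open>m\<close> in the column 0, then right to the last column, then up.\<close>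

definition critical_path :: "nat \<Rightarrow> nat \<Rightarrow> nat \<Rightarrow> nat \<Rightarrow> nat" where
  "critical_path n1 n2 m i = (if i = 0 then 0 else if i \<le> n1 then m else n2)"

lemma critical_path_mem: "m \<le> n2 \<Longrightarrow> critical_path n1 n2 m \<in> lattice_paths n1 n2"
  by (auto simp: critical_path_def lattice_paths_def)

text \<open>The path cannot leave the column 0 below the height \<open>m2\<close> by \<open>flat_row_contradiction\<close>. It cannot
leave it above, and cannot rise again before the last column, since this would create an early cell
that is not in the restriction or a corner that is not early.\<close>

lemma critical_path_unique:
  assumes h: "h \<in> lattice_paths n1 n2" and m: "m1 \<le> n1" "m2 \<le> n2" "m2 = 0 \<or> 1 \<le> m1"
    and eq: "restriction n1 m1 m2 h = early_cells n1 m1 m2 h"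
  shows "h = critical_path n1 n2 m2"
proof -
  have h0: "h 0 = 0" using h by (simp add: lattice_paths_def)
  \<comment> \<open>If the column 0 were left above \<open>m2\<close>, then \<open>(0, m2)\<close> would be early, but neither the top of its
    column nor in a prescribed row; and for \<open>m1 = 0\<close> the corner would not be early.\<close>
  have h1: "h 1 = m2" if n1: "1 \<le> n1"
  proof -
    have "m2 \<le> h 1"
      using flat_row_contradiction[OF h n1 m(1), of m2 m1 m2] eq by fastforce
    moreover have False if gt: "m2 < h 1"
    proof (cases "m1 = 0")
      case True
      then have "m2 = 0" using m by simp
      have "(0, h 1) \<in> restriction n1 m1 m2 h"
        using gt h0 n1 by (auto simp: restriction_def corners_def)
      then show False using eq True \<open>m2 = 0\<close> by (auto simp: early_cells_def)
    next
      case False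
      have "(0, m2) \<in> restriction n1 m1 m2 h"
        using False gt h0 by (auto simp: eq early_cells_def path_cells_def)
      then show False using gt h0 by (auto simp: restriction_def corners_def)
    qed
    ultimately show ?thesis by fastforce
  qed
  have flat: "h (Suc i) = h i" if i: "1 \<le> i" "i < n1" for i
  proof (rule ccontr)
    assume ne: "h (Suc i) \<noteq> h i"
    then have lt: "h i < h (Suc i)" using path_mono[OF h, of i "Suc i"] by simp
    have mi: "m2 \<le> h i" using path_mono[OF h, of 1 i] h1 i by simp
    show False
    proof (cases "i < m1")
      case True
      have "(i, h i) \<in> restriction n1 m1 m2 h"
        using True lt i by (auto simp: eq early_cells_def path_cells_def)
      then show False using lt mi by (auto simp: restriction_def corners_def)
    next
      case False
      have "(i, h (Suc i)) \<in> restriction n1 m1 m2 h"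
        using lt i by (auto simp: restriction_def corners_def)
      then show False using False mi lt by (auto simp: eq early_cells_def)
    qed
  qed
  have "h i = m2" if "1 \<le> i" "i \<le> n1" for i
    using that
  proof (induction i rule: nat_induct_at_least)
    case base
    then show ?case using h1 by simp
  next
    case (Suc i)
    then show ?case using flat[of i] by simp
  qed
  then show ?thesis using h h0
    by (auto simp: fun_eq_iff critical_path_def lattice_paths_def)
qed

lemma critical_path_critical:
  assumes m: "m1 \<le> n1" "m2 \<le> n2" "m2 = 0 \<or> 1 \<le> m1"
  shows "restriction n1 m1 m2 (critical_path n1 n2 m2) = early_cells n1 m1 m2 (critical_path n1 n2 m2)"
    and "card (early_cells n1 m1 m2 (critical_path n1 n2 m2)) = m1 + m2"
proof -
  let ?h = "critical_path n1 n2 m2"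
  have cells: "(i, j) \<in> path_cells n1 ?h \<longleftrightarrow>
     i \<le> n1 \<and> (i = 0 \<or> m2 \<le> j) \<and> (if i = n1 then j \<le> n2 else j \<le> m2)" for i j
    by (auto simp: path_cells_def critical_path_def)
  have early: "early_cells n1 m1 m2 ?h = {0} \<times> {..<m2} \<union> {..<m1} \<times> {m2}"
  proof -
    have "(i, j) \<in> early_cells n1 m1 m2 ?h \<longleftrightarrow> (i, j) \<in> {0} \<times> {..<m2} \<union> {..<m1} \<times> {m2}" for i j
      by (simp add: early_cells_def cells) (use m in auto)
    then show ?thesis by auto
  qed
  show "card (early_cells n1 m1 m2 ?h) = m1 + m2"
    unfolding early by (subst card_Un_disjoint) (auto simp: card_cartesian_product)
  have "(i, j) \<in> restriction n1 m1 m2 ?h \<longleftrightarrow> (i, j) \<in> early_cells n1 m1 m2 ?h" for i j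
    unfolding early restriction_def corners_def
    by (simp add: cells) (use m in \<open>auto simp: critical_path_def split: if_splits\<close>)
  then show "restriction n1 m1 m2 ?h = early_cells n1 m1 m2 ?h" by auto
qed

section \<open>Shelling a geometric simplicial complex\<close>

context geometric_realization
begin

definition geometric_complex :: "'c set set" where
  "geometric_complex = (\<lambda>c. convex hull (p ` c)) ` \<Delta>"

lemma inj_on_face: "c \<in> \<Delta> \<Longrightarrow> inj_on p c"
  using inj_vertices by (rule inj_on_subset) blast

lemma vertex_support_face:
  assumes c: "c \<in> \<Delta>" and x: "x \<in> convex hull (p ` c)"
  shows "vertex_support (p ` c) x = p ` supp x"
proof -
  have sub: "supp x \<subseteq> c" "x \<in> Q" using hull_iff[OF c] x by auto
  have "x \<notin> convex hull (p ` c - {p q}) \<longleftrightarrow> q \<in> supp x" if q: "q \<in> c" for q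
  proof -
    have "p ` c - {p q} = p ` (c - {q})" using inj_on_face[OF c] q by (auto simp: inj_on_def)
    then show ?thesis using hull_iff[OF subface[OF c, of "c - {q}"]] sub by auto
  qed
  then show ?thesis using sub unfolding vertex_support_def by blast
qed

lemma supp_surj:
  assumes c: "c \<in> \<Delta>" "c \<noteq> {}"
  shows "\<exists>x\<in>Q. supp x = c"
proof -
  obtain x where xc: "x \<in> convex hull (p ` c)" and x: "vertex_support (p ` c) x = p ` c"
    using exists_vertex_support[OF independent[OF c(1)] order_refl] c(2) by blast
  then have "supp x \<subseteq> c" "x \<in> Q" using hull_iff[OF c(1)] by auto
  moreover have "p ` supp x = p ` c" using vertex_support_face[OF c(1) xc] x by simp
  ultimately show ?thesis using inj_on_image_eq_iff[OF inj_on_face[OF c(1)]] by blast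
qed

lemma simplicial_complex_geometric: "simplicial_complex geometric_complex"
  unfolding simplicial_complex_def
proof (intro conjI ballI allI impI)
  show "finite geometric_complex" using finite_complex by (simp add: geometric_complex_def)
  show "\<exists>n. n simplex S" if S: "S \<in> geometric_complex" for S
  proof -
    obtain c where "c \<in> \<Delta>" "S = convex hull (p ` c)" using S by (auto simp: geometric_complex_def)
    then have "(int (card (p ` c)) - 1) simplex S"
      using independent unfolding simplex_def by (intro exI[of _ "p ` c"]) simp
    then show ?thesis by blast
  qed
  show "F \<in> geometric_complex" if F: "S \<in> geometric_complex \<and> F face_of S" for F S
  proof -
    obtain c where c: "c \<in> \<Delta>" "S = convex hull (p ` c)" using F by (auto simp: geometric_complex_def)
    then obtain d where "d \<subseteq> p ` c" "F = convex hull d"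
      using F face_of_convex_hull_affine_independent[OF independent[OF c(1)]] by blast
    then obtain e where "e \<subseteq> c" "F = convex hull (p ` e)" by (metis subset_imageE)
    then show ?thesis using subface[OF c(1)] by (auto simp: geometric_complex_def)
  qed
  show "S \<inter> S' face_of S" if SS: "S \<in> geometric_complex \<and> S' \<in> geometric_complex" for S S'
  proof -
    obtain c c' where c: "c \<in> \<Delta>" "S = convex hull (p ` c)" and c': "c' \<in> \<Delta>" "S' = convex hull (p ` c')"
      using SS by (auto simp: geometric_complex_def)
    have "c \<inter> c' \<in> \<Delta>" using subface[OF c(1)] by blast
    then have eq: "S \<inter> S' = convex hull (p ` (c \<inter> c'))"
      using hull_iff c c' by (auto simp: set_eq_iff)
    have "p ` (c \<inter> c') \<subseteq> p ` c" by blast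
    then have "convex hull (p ` (c \<inter> c')) face_of convex hull (p ` c)"
      using face_of_convex_hull_affine_independent[OF independent[OF c(1)]] by metis
    then show ?thesis unfolding eq unfolding c(2) .
  qed
qed

lemma Union_geometric_complex: "\<Union>geometric_complex = Q"
proof
  show "\<Union>geometric_complex \<subseteq> Q" using hull_iff by (auto simp: geometric_complex_def)
  show "Q \<subseteq> \<Union>geometric_complex"
  proof
    fix x assume x: "x \<in> Q"
    then have "x \<in> convex hull (p ` supp x)" using hull_iff[OF supp_face[OF x]] by simp
    then show "x \<in> \<Union>geometric_complex" using supp_face[OF x] by (auto simp: geometric_complex_def)
  qed
qed

lemma vertices_geometric_complex: "{u. {u} \<in> geometric_complex} = p ` {q. {q} \<in> \<Delta>}"
proof -
  have "u \<in> p ` {q. {q} \<in> \<Delta>}" if u: "{u} \<in> geometric_complex" for u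
  proof -
    obtain c where c: "c \<in> \<Delta>" "{u} = convex hull (p ` c)" using u by (auto simp: geometric_complex_def)
    then have "p ` c \<subseteq> {u}" by (metis hull_subset)
    moreover have "c \<noteq> {}" using c by auto
    ultimately obtain q where q: "q \<in> c" "p q = u" by blast
    then have "{q} \<in> \<Delta>" using subface[OF c(1)] by blast
    then show ?thesis using q by blast
  qed
  moreover have "{p q} \<in> geometric_complex" if "{q} \<in> \<Delta>" for q
    unfolding geometric_complex_def by (rule image_eqI[OF _ that]) simp
  ultimately show ?thesis by auto
qed

end

text \<open>Exchanging the coordinates of the grid keeps the triangulation of the product, but it reverses the
roles of rows and columns in the shelling.\<close>

lemma geometric_realization_swap:
  assumes "geometric_realization (grid_chains n1 n2) p Q supp"
  shows "geometric_realization (grid_chains n2 n1) (p \<circ> prod.swap) Q (\<lambda>x. prod.swap ` supp x)"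
proof -
  interpret geometric_realization "grid_chains n1 n2" p Q supp by fact
  have sw: "prod.swap ` c \<in> grid_chains m n \<longleftrightarrow> c \<in> grid_chains n m" for c m n
  proof -
    have "prod.swap ` c \<in> grid_chains m n" if "c \<in> grid_chains n m" for c m n
      using that by (fastforce simp: grid_chains_def comparable_def)
    from this[of c n m] this[of "prod.swap ` c" m n] show ?thesis by (auto simp: image_image)
  qed
  have sub: "prod.swap ` s \<subseteq> c \<longleftrightarrow> s \<subseteq> prod.swap ` c" for s c :: "(nat \<times> nat) set"
  proof -
    have "prod.swap ` prod.swap ` s = s" "prod.swap ` prod.swap ` c = c" by (simp_all add: image_image)
    then show ?thesis by (metis image_mono)
  qed
  show ?thesis
  proof
    show "finite (grid_chains n2 n1)"
    by (rule finite_subset[of _ "Pow ({..n2} \<times> {..n1})"]) (auto simp: grid_chains_def)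
    have un: "prod.swap ` \<Union>(grid_chains n2 n1) \<subseteq> \<Union>(grid_chains n1 n2)"
      using sw by blast
    show "inj_on (p \<circ> prod.swap) (\<Union>(grid_chains n2 n1))"
      by (intro comp_inj_on inj_on_subset[OF inj_vertices] un) (metis inj_onI swap_swap)
    show "\<not> affine_dependent ((p \<circ> prod.swap) ` c)" if "c \<in> grid_chains n2 n1" for c
      unfolding image_comp[symmetric] using independent sw that by blast
    show "x \<in> convex hull ((p \<circ> prod.swap) ` c) \<longleftrightarrow> x \<in> Q \<and> prod.swap ` supp x \<subseteq> c"
      if "c \<in> grid_chains n2 n1" for c x
      unfolding image_comp[symmetric] sub using hull_iff sw that by blast
  qed (use sw supp_face finite_grid_chain grid_chains_subset in blast)+
qed

text \<open>The combinatorial data of a shelling of a union of open simplices, namely of those whose vertex set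
satisfies \<open>Sf\<close>. Each facet \<open>C h\<close> contributes the faces that contain \<open>R h\<close> and are not contained
in \<open>D h\<close>. The assumption on \<open>key\<close> says that a face is contributed by the first of the facets
containing it; the relation \<open>lt\<close> orders the vertices of every simplex, and it is
needed only for the orientation of the edges.\<close>

locale shelling_data = geometric_realization \<Delta> p Q supp
  for \<Delta> :: "'i set set" and p :: "'i \<Rightarrow> 'c::euclidean_space" and Q supp +
  fixes H :: "'h set" and C R D :: "'h \<Rightarrow> 'i set" and key :: "'h \<Rightarrow> nat"
    and Sf :: "'i set \<Rightarrow> bool" and lt :: "'i \<Rightarrow> 'i \<Rightarrow> bool" and n :: nat
  assumes finite_H: "finite H"
    and facet: "h \<in> H \<Longrightarrow> C h \<in> \<Delta>" "h \<in> H \<Longrightarrow> card (C h) = n + 1"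
    and data: "h \<in> H \<Longrightarrow> R h \<subseteq> C h" "h \<in> H \<Longrightarrow> D h \<subset> C h"
      "h \<in> H \<Longrightarrow> D h \<noteq> {} \<Longrightarrow> R h \<noteq> {}"
    and cover: "c \<in> \<Delta> \<Longrightarrow> Sf c \<Longrightarrow> \<exists>h\<in>H. R h \<subseteq> c \<and> c \<subseteq> C h \<and> \<not> c \<subseteq> D h"
    and sound: "h \<in> H \<Longrightarrow> R h \<subseteq> c \<Longrightarrow> c \<subseteq> C h \<Longrightarrow> \<not> c \<subseteq> D h \<Longrightarrow> Sf c"
    and order: "h \<in> H \<Longrightarrow> h' \<in> H \<Longrightarrow> R h \<subseteq> c \<Longrightarrow> c \<subseteq> C h \<Longrightarrow> c \<subseteq> C h' \<Longrightarrow>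
      h = h' \<or> key h < key h'"
    and lt_total: "c \<in> \<Delta> \<Longrightarrow> q \<in> c \<Longrightarrow> r \<in> c \<Longrightarrow> q \<noteq> r \<Longrightarrow> lt q r \<or> lt r q"
    and lt_trans: "lt q r \<Longrightarrow> lt r s \<Longrightarrow> lt q s" and lt_irrefl: "\<not> lt q q"
    and initial: "h \<in> H \<Longrightarrow> q \<in> D h \<Longrightarrow> r \<in> C h \<Longrightarrow> r \<notin> D h \<Longrightarrow> lt q r"
    and dense: "closure {x \<in> Q. Sf (supp x)} = Q"
begin

definition S :: "'c set" where "S = {x \<in> Q. Sf (supp x)}"

definition tile :: "'h \<Rightarrow> 'c set" where
  "tile h = vertex_tile (p ` C h) (p ` R h) (p ` D h)"

lemma tile_data_tile:
  assumes h: "h \<in> H"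
  shows "tile_data (p ` C h) (p ` R h) (p ` D h)"
proof -
  have "p ` D h \<subset> p ` C h"
    using data(2)[OF h] inj_on_face[OF facet(1)[OF h]] by (simp add: image_strict_mono)
  then show ?thesis
    using data[OF h] independent[OF facet(1)[OF h]] by (auto simp: tile_data_def)
qed

lemma tile_eq:
  assumes h: "h \<in> H"
  shows "tile h = {x \<in> Q. R h \<subseteq> supp x \<and> supp x \<subseteq> C h \<and> \<not> supp x \<subseteq> D h}"
proof -
  note inj = inj_on_face[OF facet(1)[OF h]]
  have "x \<in> tile h \<longleftrightarrow> x \<in> Q \<and> supp x \<subseteq> C h \<and> p ` R h \<subseteq> p ` supp x \<and> \<not> p ` supp x \<subseteq> p ` D h" for x
    using vertex_support_face[OF facet(1)[OF h], of x] hull_iff[OF facet(1)[OF h], of x]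
    by (cases "x \<in> convex hull (p ` C h)") (simp_all add: tile_def vertex_tile_def, blast)
  moreover have "p ` A \<subseteq> p ` B \<longleftrightarrow> A \<subseteq> B" if "A \<subseteq> C h" "B \<subseteq> C h" for A B
    using inj_on_image_subset_iff[OF inj] that by blast
  moreover have "D h \<subseteq> C h" using data(2)[OF h] by blast
  ultimately show ?thesis using data(1)[OF h] by (intro set_eqI) (metis (no_types, lifting) mem_Collect_eq)
qed

lemma tile_nonempty:
  assumes h: "h \<in> H"
  shows "tile h \<noteq> {}"
proof -
  have "C h \<noteq> {}" using data(2)[OF h] by blast
  then obtain x where "x \<in> Q" "supp x = C h" using supp_surj[OF facet(1)[OF h]] by blast
  then have "x \<in> tile h" using tile_eq[OF h] data[OF h] by blast
  then show ?thesis by blast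
qed

lemma tile_order:
  assumes h: "h \<in> H" "h' \<in> H" and x: "x \<in> tile h" "supp x \<subseteq> C h'"
  shows "h = h' \<or> key h < key h'"
  using order[OF h, of "supp x"] x tile_eq[OF h(1)] by blast

lemma tile_disjoint:
  assumes h: "h \<in> H" "h' \<in> H" and x: "x \<in> tile h" "x \<in> tile h'"
  shows "h = h'"
proof -
  have "supp x \<subseteq> C h" "supp x \<subseteq> C h'" using x tile_eq h by auto
  then show ?thesis using tile_order[OF h x(1)] tile_order[OF h(2,1) x(2)] by fastforce
qed

lemma Union_tiles: "\<Union>(tile ` H) = S"
proof
  show "\<Union>(tile ` H) \<subseteq> S" using sound tile_eq by (force simp: S_def)
  show "S \<subseteq> \<Union>(tile ` H)"
  proof
    fix x assume x: "x \<in> S"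
    then obtain h where "h \<in> H" "R h \<subseteq> supp x \<and> supp x \<subseteq> C h \<and> \<not> supp x \<subseteq> D h"
      using cover[of "supp x"] supp_face[of x] by (auto simp: S_def)
    then show "x \<in> \<Union>(tile ` H)" using x tile_eq by (auto simp: S_def)
  qed
qed

lemma tile_dim_iff:
  assumes h: "h \<in> H"
  shows "morse_tile_dim m (tile h) \<longleftrightarrow> m = n"
proof -
  have card: "card (p ` C h) = n + 1"
    using facet(2)[OF h] card_image[OF inj_on_face[OF facet(1)[OF h]]] by simp
  note d = tile_data_tile[OF h]
  show ?thesis
    using vertex_tile_morse[OF d card] vertex_tile_morse_data(1)[OF d] card
    unfolding morse_tile_dim_def tile_def by (metis add_right_cancel)
qed

lemma tile_basic:
  assumes "h \<in> H" "D h = {}"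
  shows "basic_tile (tile h)"
  using vertex_tile_basic tile_data_tile[OF assms(1)] assms(2) by (simp add: tile_def)

text \<open>If \<open>D h\<close> has codimension one and equals \<open>R h\<close>, the tile is an open simplex, and its index \<open>n\<close>
is again the cardinality of \<open>R h\<close>.\<close>

lemma tile_critical_iff:
  assumes h: "h \<in> H"
  shows "critical_tile_of_index i (tile h) \<longleftrightarrow>
    R h = D h \<and> i = card (R h) \<or> R h = C h \<and> i = n"
proof -
  note inj = inj_on_face[OF facet(1)[OF h]]
  have D: "D h \<subseteq> C h" using data(2)[OF h] by blast
  have "card (p ` C h) = n + 1" "card (p ` R h) = card (R h)"
    using facet(2)[OF h] card_image[OF inj] card_image[OF inj_on_subset[OF inj data(1)[OF h]]] by auto
  moreover have "p ` R h = p ` D h \<longleftrightarrow> R h = D h" "p ` R h = p ` C h \<longleftrightarrow> R h = C h"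
    using inj_on_image_eq_iff[OF inj] data(1)[OF h] D by auto
  ultimately show ?thesis
    using critical_vertex_tile_iff[OF tile_data_tile[OF h]] by (auto simp: tile_def critical_data_def)
qed

lemma morse_tiling_tiles: "morse_tiling geometric_complex S (tile ` H)"
  unfolding morse_tiling_def
proof (intro conjI ballI allI)
  show "simplicial_complex geometric_complex" by (rule simplicial_complex_geometric)
  show "S \<subseteq> \<Union>geometric_complex" by (auto simp: Union_geometric_complex S_def)
  show "partition_on S (tile ` H)"
  proof (rule partition_onI)
    show "\<Union>(tile ` H) = S" by (rule Union_tiles)
    show "disjnt T T'" if "T \<in> tile ` H" "T' \<in> tile ` H" "T \<noteq> T'" for T T'
      using that tile_disjoint unfolding disjnt_def by blast
    show "{} \<notin> tile ` H" using tile_nonempty by force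
  qed
  show "\<exists>\<sigma>\<in>geometric_complex. \<exists>n k \<mu>. morse_tile_on n k \<sigma> \<mu> T" if T: "T \<in> tile ` H" for T
  proof -
    obtain h where h: "h \<in> H" "T = tile h" using T by blast
    have card: "card (p ` C h) = n + 1"
      using facet(2)[OF h(1)] card_image[OF inj_on_face[OF facet(1)[OF h(1)]]] by simp
    show ?thesis
      using vertex_tile_morse[OF tile_data_tile[OF h(1)] card] facet(1)[OF h(1)]
      unfolding h(2) tile_def geometric_complex_def by blast
  qed
  fix j
  have "{T \<in> tile ` H. \<exists>m\<ge>j. morse_tile_dim m T} = (if j \<le> n then tile ` H else {})"
    using tile_dim_iff by auto
  then show "closedin (top_of_set S) (\<Union>{T \<in> tile ` H. \<exists>m\<ge>j. morse_tile_dim m T})"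
    using Union_tiles by simp
qed

text \<open>Sort the facets by \<open>key\<close>. The union of the first tiles is the intersection of \<open>S\<close> with the union of
the first facets, because a point in one of these facets belongs to the tile of the same or of an
earlier facet. So it is closed in \<open>S\<close>.\<close>

lemma morse_shelling_tiles: "\<exists>N P. morse_shelling geometric_complex S (tile ` H) N P"
proof -
  obtain xs where xs: "set xs = H" "distinct xs" using finite_distinct_list[OF finite_H] by blast
  define hs where "hs = sort_key key xs"
  have hs: "set hs = H" "distinct hs" "sorted (map key hs)" using xs by (auto simp: hs_def)
  define P where "P i = (\<Union>h\<in>set (take i hs). tile h)" for i
  have mem: "hs ! j \<in> H" if "j < length hs" for j using that hs(1) nth_mem by blast
  \<comment> \<open>Adding points of \<open>S\<close> that lie in the first facets but not in their tiles changes nothing.\<close>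
  have P_eq: "P i = S \<inter> (\<Union>h\<in>set (take i hs). convex hull (p ` C h))" for i
  proof
    show "P i \<subseteq> S \<inter> (\<Union>h\<in>set (take i hs). convex hull (p ` C h))"
    proof
      fix x assume "x \<in> P i"
      then obtain h where h: "h \<in> set (take i hs)" "x \<in> tile h" by (auto simp: P_def)
      then have hH: "h \<in> H" using hs(1) set_take_subset by fast
      then have "x \<in> S" using Union_tiles h(2) by blast
      moreover have "x \<in> convex hull (p ` C h)"
        using h(2) by (simp add: tile_def vertex_tile_def)
      ultimately show "x \<in> S \<inter> (\<Union>h\<in>set (take i hs). convex hull (p ` C h))" using h(1) by blast
    qed
    show "S \<inter> (\<Union>h\<in>set (take i hs). convex hull (p ` C h)) \<subseteq> P i"
    proof
      fix x assume "x \<in> S \<inter> (\<Union>h\<in>set (take i hs). convex hull (p ` C h))"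
      then obtain j where xS: "x \<in> S" and j: "j < i" "j < length hs" "x \<in> convex hull (p ` C (hs ! j))"
        by (auto simp: in_set_conv_nth)
      obtain h where h: "h \<in> H" "x \<in> tile h" using xS Union_tiles by blast
      obtain k where k: "k < length hs" "h = hs ! k" using h(1) hs(1) by (metis in_set_conv_nth)
      have "supp x \<subseteq> C (hs ! j)" using hull_iff[OF facet(1)[OF mem[OF j(2)]]] j(3) by blast
      then have "h = hs ! j \<or> key h < key (hs ! j)" using tile_order[OF h(1) mem[OF j(2)] h(2)] by blast
      moreover have "key (hs ! j) \<le> key h" if "j \<le> k"
        using sorted_nth_mono[OF hs(3), of j k] that k by simp
      ultimately have "h = hs ! j \<or> k < j" by (meson not_le)
      then have "h \<in> set (take i hs)"
        using j k by (metis in_set_conv_nth length_take less_trans min_less_iff_conj nth_take)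
      then show "x \<in> P i" using h(2) by (auto simp: P_def)
    qed
  qed
  have "compact (convex hull (p ` C h))" if "h \<in> H" for h
    using finite_face[OF facet(1)[OF that]] by (simp add: finite_imp_compact_convex_hull)
  then have "closed (\<Union>h\<in>set (take i hs). convex hull (p ` C h))" for i
    using hs(1) set_take_subset[of i hs] by (intro closed_UN) (auto intro: compact_imp_closed)
  then have closed: "closedin (top_of_set S) (P i)" for i
    unfolding P_eq by (intro closedin_closed_Int)
  have step: "P i \<inter> tile (hs ! i) = {}" "P (Suc i) = P i \<union> tile (hs ! i)" if i: "i < length hs" for i
  proof -
    have "h \<noteq> hs ! i \<and> h \<in> H" if h: "h \<in> set (take i hs)" for h
    proof -
      obtain j where "j < i" "h = hs ! j" using h i by (auto simp: in_set_conv_nth)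
      then show ?thesis using hs(2) i mem by (auto simp: nth_eq_iff_index_eq)
    qed
    then show "P i \<inter> tile (hs ! i) = {}"
      using tile_disjoint[OF mem[OF i]] unfolding P_def by blast
    show "P (Suc i) = P i \<union> tile (hs ! i)" using i by (auto simp: P_def take_Suc_conv_app_nth)
  qed
  have "morse_shelling geometric_complex S (tile ` H) (length hs) P"
    unfolding morse_shelling_def morse_tiled_subset_def
  proof (intro conjI allI impI)
    show "P 0 = {}" "P (length hs) = S" using Union_tiles hs(1) by (auto simp: P_def)
    show "\<exists>\<U>\<subseteq>tile ` H. P i = \<Union>\<U>" for i
      unfolding P_def using hs(1) set_take_subset[of i hs] by (intro exI[of _ "tile ` set (take i hs)"]) blast
    show "closedin (top_of_set S) (P i)" for i by (rule closed)
    show "P i \<subset> P (Suc i)" "P (Suc i) - P i \<in> tile ` H" if "i < length hs" for i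
    proof -
      have "P (Suc i) - P i = tile (hs ! i)" using step[OF that] by blast
      then show "P (Suc i) - P i \<in> tile ` H" using mem[OF that] by simp
      show "P i \<subset> P (Suc i)" using step[OF that] tile_nonempty[OF mem[OF that]] by blast
    qed
  qed (rule morse_tiling_tiles)
  then show ?thesis by blast
qed

text \<open>Every edge is oriented from its larger to its smaller vertex with respect to \<open>lt\<close>.\<close>

lemma tame_tiles: "tame geometric_complex S (tile ` H)"
proof -
  have closS: "closure S = Q" using dense by (simp add: S_def)
  have under: "underlying_complex geometric_complex S = geometric_complex"
    using Union_geometric_complex closS by (auto simp: underlying_complex_def)
  define r where "r = {(p q, p q') | q q'. lt q' q \<and> {q, q'} \<in> \<Delta>}"
  have pin: "q = u" if "p q = p u" "q \<in> \<Union>\<Delta>" "u \<in> \<Union>\<Delta>" for q u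
    using inj_vertices that by (rule inj_onD)
  have edge: "(p q, p q') \<in> r \<longleftrightarrow> lt q' q" if qq: "{q, q'} \<in> \<Delta>" for q q'
  proof
    assume "(p q, p q') \<in> r"
    then obtain u u' where u: "p q = p u" "p q' = p u'" "lt u' u" "{u, u'} \<in> \<Delta>"
      by (auto simp: r_def)
    have "q = u" "q' = u'" by (rule pin; use u qq in blast)+
    then show "lt q' q" using u(3) by simp
  qed (use qq in \<open>auto simp: r_def\<close>)
  have asym: "\<not> (lt q q' \<and> lt q' q)" for q q'
    using lt_trans lt_irrefl by metis
  have orient: "edge_orientation geometric_complex r"
    unfolding edge_orientation_def
  proof (intro conjI allI impI)
    show "\<forall>(u, v)\<in>r. u \<noteq> v \<and> convex hull {u, v} \<in> geometric_complex"
    proof (clarify)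
      fix u v assume "(u, v) \<in> r"
      then obtain q q' where q: "u = p q" "v = p q'" "lt q' q" "{q, q'} \<in> \<Delta>" by (auto simp: r_def)
      then have "q \<noteq> q'" using lt_irrefl by blast
      then have "u \<noteq> v" using inj_on_face[OF q(4)] q by (auto simp: inj_on_def)
      moreover have "convex hull {u, v} \<in> geometric_complex" using q by (force simp: geometric_complex_def)
      ultimately show "u \<noteq> v \<and> convex hull {u, v} \<in> geometric_complex" by blast
    qed
    fix u v assume uv: "u \<noteq> v \<and> convex hull {u, v} \<in> geometric_complex"
    then obtain c where c: "c \<in> \<Delta>" "convex hull {u, v} = convex hull (p ` c)" by (auto simp: geometric_complex_def)
    have "y \<in> {u, v} \<longleftrightarrow> y \<in> p ` c" for y
      using extreme_point_of_convex_hull_affine_independent[OF affine_independent_2, of y u v]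
        extreme_point_of_convex_hull_affine_independent[OF independent[OF c(1)], of y] c(2) by simp
    then obtain q q' where q: "q \<in> c" "q' \<in> c" "u = p q" "v = p q'" by blast
    then have "{q, q'} \<in> \<Delta>" "{q', q} \<in> \<Delta>" using subface[OF c(1)] by auto
    moreover have "q \<noteq> q'" using uv q by blast
    ultimately show "(u, v) \<in> r \<longleftrightarrow> (v, u) \<notin> r"
      using edge lt_total[OF c(1) q(1,2)] asym unfolding q(3,4) by blast
  qed
  have acyclic: "\<not> ((u, v) \<in> r \<and> (v, w) \<in> r \<and> (w, u) \<in> r)" for u v w
  proof
    assume "(u, v) \<in> r \<and> (v, w) \<in> r \<and> (w, u) \<in> r"
    then obtain a b c d e f where *: "u = p a" "v = p b" "lt b a" "{a, b} \<in> \<Delta>"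
      "v = p c" "w = p d" "lt d c" "{c, d} \<in> \<Delta>" "w = p e" "u = p f" "lt f e" "{e, f} \<in> \<Delta>"
      unfolding r_def by blast
    have "a \<in> \<Union>\<Delta>" "b \<in> \<Union>\<Delta>" "c \<in> \<Union>\<Delta>" "d \<in> \<Union>\<Delta>" "e \<in> \<Union>\<Delta>" "f \<in> \<Union>\<Delta>"
      using *(4,8,12) by blast+
    then have "b = c" "d = e" "f = a" using pin *(1,2,5,6,9,10) by metis+
    then have "lt b a" "lt d b" "lt a d" using *(3,7,11) by simp_all
    then show False using lt_trans lt_irrefl by metis
  qed
  have morse: "(u, v) \<in> r"
    if T: "T \<in> tile ` H" "morse_tile_on m k \<sigma> \<mu> T" "\<mu> \<noteq> {}"
      and uv: "u extreme_point_of \<sigma>" "u \<notin> \<mu>" "v extreme_point_of \<mu>" for T m k \<sigma> \<mu> u v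
  proof -
    obtain h where h: "h \<in> H" "T = tile h" using T(1) by blast
    note d = vertex_tile_morse_data[OF tile_data_tile[OF h(1)], folded tile_def, of m k \<sigma> \<mu>]
    have \<sigma>: "\<sigma> = convex hull (p ` C h)" and \<mu>: "\<mu> = convex hull (p ` D h)"
      using d T(2,3) h(2) by auto
    note C = facet(1)[OF h(1)]
    have D: "D h \<in> \<Delta>" using subface[OF C] data(2)[OF h(1)] by blast
    obtain q where q: "q \<in> C h" "u = p q"
      using uv(1) extreme_point_of_convex_hull_affine_independent[OF independent[OF C]] \<sigma> by auto
    obtain q' where q': "q' \<in> D h" "v = p q'"
      using uv(3) extreme_point_of_convex_hull_affine_independent[OF independent[OF D]] \<mu> by auto
    have "q \<notin> D h" using uv(2) q(2) \<mu> by (auto simp: hull_inc)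
    then have "lt q' q" using initial[OF h(1) q'(1) q(1)] by blast
    moreover have "q' \<in> C h" using q'(1) data(2)[OF h(1)] by blast
    then have "{q, q'} \<in> \<Delta>" using subface[OF C, of "{q, q'}"] q(1) by simp
    ultimately show ?thesis unfolding q(2) q'(2) r_def by blast
  qed
  show ?thesis unfolding tame_def under
  proof (intro exI[of _ r] conjI)
    show "edge_orientation geometric_complex r" by (rule orient)
    show "\<forall>u v w. convex hull {u, v, w} \<in> geometric_complex \<and> 2 simplex convex hull {u, v, w} \<longrightarrow>
        \<not> ((u, v) \<in> r \<and> (v, w) \<in> r \<and> (w, u) \<in> r)"
      using acyclic by metis
    show "\<forall>T\<in>tile ` H. \<forall>n k \<sigma> \<mu>. morse_tile_on n k \<sigma> \<mu> T \<and> \<mu> \<noteq> {} \<longrightarrow>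
        (\<forall>u v. u extreme_point_of \<sigma> \<and> u \<notin> \<mu> \<and> v extreme_point_of \<mu> \<longrightarrow> (u, v) \<in> r)"
      using morse by metis
  qed
qed

lemma pure_dimensional_tiles: "pure_dimensional (tile ` H)"
  unfolding pure_dimensional_def by (intro exI[of _ n]) (auto simp: tile_dim_iff)

end

section \<open>Tame shellings of products of tiles\<close>

text \<open>The condition on the support of a point of the staircase triangulation that describes a product of two
tiles with numbered vertices.\<close>

definition grid_pattern :: "nat \<Rightarrow> nat \<Rightarrow> nat \<Rightarrow> nat \<Rightarrow> (nat \<times> nat) set \<Rightarrow> bool" where
  "grid_pattern a1 m1 a2 m2 c \<longleftrightarrow>
     {..<a1} \<subseteq> fst ` c \<and> \<not> fst ` c \<subseteq> {..<m1} \<and> {..<a2} \<subseteq> snd ` c \<and> \<not> snd ` c \<subseteq> {..<m2}"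

definition tame_shelling_on :: "'a::euclidean_space set \<Rightarrow> 'a set \<Rightarrow> 'a set \<Rightarrow> 'a set set \<Rightarrow> bool" where
  "tame_shelling_on W Q S \<T> \<longleftrightarrow>
     (\<exists>K N P. simplicial_complex K \<and> \<Union>K = Q \<and> {u. {u} \<in> K} = W \<and>
        morse_shelling K S \<T> N P \<and> tame K S \<T> \<and> pure_dimensional \<T>)"

text \<open>A chain is contributed by the lowest path through it, which has a smaller area than any other path
through the chain.\<close>

lemma staircase_shelling_data:
  assumes real: "geometric_realization (grid_chains n1 n2) p Q supp"
    and a: "a1 \<le> n1" "a2 \<le> Suc n2" "a2 = 0 \<or> 1 \<le> a1"
    and m: "m1 \<le> n1" "m2 \<le> n2" "m1 = 0 \<or> 1 \<le> a1" "m2 = 0 \<or> 1 \<le> a2"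
    and dense: "closure {x \<in> Q. grid_pattern a1 m1 a2 m2 (supp x)} = Q"
  shows "shelling_data (grid_chains n1 n2) p Q supp (lattice_paths n1 n2) (path_cells n1)
    (restriction n1 a1 a2) (early_cells n1 m1 m2) (\<lambda>h. \<Sum>i\<le>n1. h i) (grid_pattern a1 m1 a2 m2)
    (\<lambda>q r. fst q \<le> fst r \<and> snd q \<le> snd r \<and> q \<noteq> r) (n1 + n2)"
proof -
  interpret geometric_realization "grid_chains n1 n2" p Q supp by fact
  show ?thesis
  proof
    show "finite (lattice_paths n1 n2)" by (rule finite_lattice_paths)
    fix h assume h: "h \<in> lattice_paths n1 n2"
    show "path_cells n1 h \<in> grid_chains n1 n2" using h by (rule path_cells_chain)
    show "card (path_cells n1 h) = n1 + n2 + 1" using h by (rule card_path_cells)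
    show "restriction n1 a1 a2 h \<subseteq> path_cells n1 h" using h by (rule restriction_subset)
    show "early_cells n1 m1 m2 h \<subset> path_cells n1 h" using h m(1,2) by (rule early_cells_psubset)
    show "restriction n1 a1 a2 h \<noteq> {}" if "early_cells n1 m1 m2 h \<noteq> {}"
    proof -
      have "m1 \<noteq> 0 \<or> m2 \<noteq> 0" using that by (auto simp: early_cells_def)
      then have "1 \<le> a1" using m(3,4) a(3) by auto
      then show ?thesis using restriction_nonempty[OF h _ a(1,2)] by blast
    qed
    show "grid_pattern a1 m1 a2 m2 c"
      if "restriction n1 a1 a2 h \<subseteq> c" "c \<subseteq> path_cells n1 h" "\<not> c \<subseteq> early_cells n1 m1 m2 h" for c
      using that restriction_iff[OF h that(2) a] early_cells_iff[OF h that(2)]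
      by (simp add: grid_pattern_def)
    show "h = h' \<or> (\<Sum>i\<le>n1. h i) < (\<Sum>i\<le>n1. h' i)"
      if h': "h' \<in> lattice_paths n1 n2" and c: "restriction n1 a1 a2 h \<subseteq> c" "c \<subseteq> path_cells n1 h'"
      for h' c
    proof -
      have "corners n1 h \<subseteq> path_cells n1 h'" using c by (auto simp: restriction_def)
      then show ?thesis using path_height_less[OF h h'] corners_minimal[OF h h'] by blast
    qed
    show "fst q \<le> fst r \<and> snd q \<le> snd r \<and> q \<noteq> r"
      if "q \<in> early_cells n1 m1 m2 h" "r \<in> path_cells n1 h" "r \<notin> early_cells n1 m1 m2 h" for q r
      using early_cells_initial[OF h that] that by blast
  next
    fix c assume c: "c \<in> grid_chains n1 n2" "grid_pattern a1 m1 a2 m2 c"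
    let ?h = "lowest_path n1 n2 c"
    note low = lowest_path[OF c(1)]
    have "restriction n1 a1 a2 ?h \<subseteq> c \<and> c \<subseteq> path_cells n1 ?h \<and> \<not> c \<subseteq> early_cells n1 m1 m2 ?h"
      using c(2) low restriction_iff[OF low(1,2) a] early_cells_iff[OF low(1,2)]
      by (simp add: grid_pattern_def)
    then show "\<exists>h\<in>lattice_paths n1 n2. restriction n1 a1 a2 h \<subseteq> c \<and> c \<subseteq> path_cells n1 h
        \<and> \<not> c \<subseteq> early_cells n1 m1 m2 h" using low(1) by blast
  next
    fix c q r assume "c \<in> grid_chains n1 n2" "q \<in> c" "r \<in> c" "q \<noteq> r"
    then show "(fst q \<le> fst r \<and> snd q \<le> snd r \<and> q \<noteq> r) \<or> (fst r \<le> fst q \<and> snd r \<le> snd q \<and> r \<noteq> q)"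
      unfolding grid_chains_def comparable_def by blast
  qed (auto simp: prod_eq_iff dense)
qed

lemma staircase_shelling:
  assumes real: "geometric_realization (grid_chains n1 n2) p Q supp"
    and a: "a1 \<le> n1" "a2 \<le> Suc n2" "a2 = 0 \<or> 1 \<le> a1"
    and m: "m1 \<le> n1" "m2 \<le> n2" "m1 = 0 \<or> 1 \<le> a1" "m2 = 0 \<or> 1 \<le> a2"
    and S: "S = {x \<in> Q. grid_pattern a1 m1 a2 m2 (supp x)}" and dense: "closure S = Q"
  shows "\<exists>tile. tame_shelling_on (p ` ({..n1} \<times> {..n2})) Q S (tile ` lattice_paths n1 n2) \<and>
    (m1 = 0 \<and> m2 = 0 \<longrightarrow> (\<forall>T\<in>tile ` lattice_paths n1 n2. basic_tile T)) \<and>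
    (\<forall>h\<in>lattice_paths n1 n2. \<forall>i. critical_tile_of_index i (tile h) \<longleftrightarrow>
       restriction n1 a1 a2 h = early_cells n1 m1 m2 h \<and> i = card (restriction n1 a1 a2 h) \<or>
       restriction n1 a1 a2 h = path_cells n1 h \<and> i = n1 + n2)"
proof -
  interpret shelling_data "grid_chains n1 n2" p Q supp "lattice_paths n1 n2" "path_cells n1"
    "restriction n1 a1 a2" "early_cells n1 m1 m2" "\<lambda>h. \<Sum>i\<le>n1. h i" "grid_pattern a1 m1 a2 m2"
    "\<lambda>q r. fst q \<le> fst r \<and> snd q \<le> snd r \<and> q \<noteq> r" "n1 + n2"
    by (rule staircase_shelling_data[OF real a m dense[unfolded S]])
  have S': "local.S = S" by (simp add: S S_def)
  have "{q. {q} \<in> grid_chains n1 n2} = {..n1} \<times> {..n2}"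
    by (auto simp: grid_chains_def comparable_def)
  then have "tame_shelling_on (p ` ({..n1} \<times> {..n2})) Q S (tile ` lattice_paths n1 n2)"
    using simplicial_complex_geometric Union_geometric_complex vertices_geometric_complex tame_tiles
      pure_dimensional_tiles morse_shelling_tiles
    unfolding tame_shelling_on_def S' by (intro exI[of _ geometric_complex]) auto
  moreover have "\<forall>T\<in>tile ` lattice_paths n1 n2. basic_tile T" if "m1 = 0" "m2 = 0"
  proof -
    have "early_cells n1 m1 m2 h = {}" for h using that by (simp add: early_cells_def)
    then show ?thesis using tile_basic by auto
  qed
  ultimately show ?thesis using tile_critical_iff by (intro exI[of _ tile]) simp
qed

lemma regular_staircase_shelling:
  assumes real: "geometric_realization (grid_chains n1 n2) p Q supp"
    and a: "1 \<le> a1" "a1 \<le> n1" "a2 \<le> Suc n2"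
    and m: "m1 = 0 \<or> a1 < m1 \<and> m1 \<le> n1" "m2 \<le> n2" "m2 = 0 \<or> 1 \<le> a2"
    and S: "S = {x \<in> Q. grid_pattern a1 m1 a2 m2 (supp x)}" "closure S = Q"
  shows "\<exists>\<T>. tame_shelling_on (p ` ({..n1} \<times> {..n2})) Q S \<T> \<and> (\<forall>T\<in>\<T>. \<not> critical_tile T) \<and>
    (m1 = 0 \<and> m2 = 0 \<longrightarrow> (\<forall>T\<in>\<T>. basic_tile T))"
proof -
  have hyps: "a2 = 0 \<or> 1 \<le> a1" "m1 \<le> n1" "m1 = 0 \<or> 1 \<le> a1" using a m by auto
  obtain tile where t: "tame_shelling_on (p ` ({..n1} \<times> {..n2})) Q S (tile ` lattice_paths n1 n2)"
    "m1 = 0 \<and> m2 = 0 \<longrightarrow> (\<forall>T\<in>tile ` lattice_paths n1 n2. basic_tile T)"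
    "\<forall>h\<in>lattice_paths n1 n2. \<forall>i. critical_tile_of_index i (tile h) \<longleftrightarrow>
       restriction n1 a1 a2 h = early_cells n1 m1 m2 h \<and> i = card (restriction n1 a1 a2 h) \<or>
       restriction n1 a1 a2 h = path_cells n1 h \<and> i = n1 + n2"
    using staircase_shelling[OF real a(2,3) hyps(1,2) m(2) hyps(3) m(3) S] by (elim exE conjE)
  have "\<not> critical_tile (tile h)" if "h \<in> lattice_paths n1 n2" for h
    using t(3) that restriction_noncritical[OF that a m(1), of m2] restriction_proper[OF that a(2)] a
    unfolding critical_tile_def by auto
  then show ?thesis using t(1,2) by (intro exI[of _ "tile ` lattice_paths n1 n2"]) auto
qed

text \<open>Both factors have the symmetric data of critical tiles, so the only critical tile is that of the
critical path.\<close>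

lemma critical_staircase_shelling:
  assumes real: "geometric_realization (grid_chains n1 n2) p Q supp"
    and k: "k1 \<le> n1" "k2 \<le> n2" "k2 = 0 \<or> 1 \<le> k1"
    and S: "S = {x \<in> Q. grid_pattern k1 k1 k2 k2 (supp x)}" "closure S = Q"
  shows "\<exists>\<T>. tame_shelling_on (p ` ({..n1} \<times> {..n2})) Q S \<T> \<and> (\<exists>!T. T \<in> \<T> \<and> critical_tile T) \<and>
    (\<forall>T\<in>\<T>. critical_tile T \<longrightarrow> critical_tile_of_index (k1 + k2) T)"
proof -
  have hyps: "k2 \<le> Suc n2" "k1 = 0 \<or> 1 \<le> k1" "k2 = 0 \<or> 1 \<le> k2" using k by auto
  obtain tile where t: "tame_shelling_on (p ` ({..n1} \<times> {..n2})) Q S (tile ` lattice_paths n1 n2)"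
    "\<forall>h\<in>lattice_paths n1 n2. \<forall>i. critical_tile_of_index i (tile h) \<longleftrightarrow>
       restriction n1 k1 k2 h = early_cells n1 k1 k2 h \<and> i = card (restriction n1 k1 k2 h) \<or>
       restriction n1 k1 k2 h = path_cells n1 h \<and> i = n1 + n2"
    using staircase_shelling[OF real k(1) hyps(1) k(3,1,2) hyps(2,3) S] by (elim exE conjE)
  let ?h = "critical_path n1 n2 k2"
  note mem = critical_path_mem[OF k(2), of n1] and crit = critical_path_critical[OF k]
  have index: "critical_tile_of_index (k1 + k2) (tile ?h)" using t(2) mem crit by simp
  have unique: "h = ?h" if "h \<in> lattice_paths n1 n2" "critical_tile (tile h)" for h
    using t(2) that restriction_proper[OF that(1) k(1), of k2] k(2)
      critical_path_unique[OF that(1) k] unfolding critical_tile_def by blast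
  have "\<exists>!T. T \<in> tile ` lattice_paths n1 n2 \<and> critical_tile T"
    using mem index unique by (intro ex1I[of _ "tile ?h"]) (auto simp: critical_tile_def)
  moreover have "\<forall>T\<in>tile ` lattice_paths n1 n2. critical_tile T \<longrightarrow> critical_tile_of_index (k1 + k2) T"
    using unique index by auto
  ultimately show ?thesis using t(1) by (intro exI[of _ "tile ` lattice_paths n1 n2"] conjI)
qed

definition labelled_tile :: "nat \<Rightarrow> (nat \<Rightarrow> 'a::euclidean_space) \<Rightarrow> nat \<Rightarrow> nat \<Rightarrow> 'a set" where
  "labelled_tile n v a m = {x \<in> convex hull (v ` {..n}).
     {..<a} \<subseteq> {i. bary n v x i \<noteq> 0} \<and> \<not> {i. bary n v x i \<noteq> 0} \<subseteq> {..<m}}"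

text \<open>Number the elements of \<open>A\<close> first, then those of \<open>M\<close> and then the others.\<close>

lemma vertex_labelling:
  fixes V :: "'a::euclidean_space set"
  assumes d: "tile_data V A M" "M = {} \<or> A \<subseteq> M" and n: "card V = n + 1"
  shows "\<exists>v. affine_frame n v \<and> v ` {..n} = V \<and>
    vertex_tile V A M = labelled_tile n v (card A) (card M)"
proof -
  have V: "\<not> affine_dependent V" "A \<subseteq> V" "M \<subseteq> V" using d by (auto simp: tile_data_def)
  have fin: "finite V" using V(1) by (rule aff_independent_finite)
  then have fins: "finite A" "finite M" using V finite_subset by blast+
  define B where "B = (if M = {} then A else M)"
  have B: "A \<subseteq> B" "B \<subseteq> V" "finite B" using V d fins by (auto simp: B_def)
  obtain xs where xs: "set xs = A" "distinct xs" using finite_distinct_list[OF fins(1)] by blast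
  obtain ys where ys: "set ys = B - A" "distinct ys"
    using finite_distinct_list[of "B - A"] B(3) by blast
  obtain zs where zs: "set zs = V - B" "distinct zs"
    using finite_distinct_list[of "V - B"] fin by blast
  let ?l = "xs @ ys @ zs"
  define v where "v i = ?l ! i" for i
  have l: "set ?l = V" "distinct ?l" using xs ys zs B by auto
  then have len: "length ?l = n + 1" using n distinct_card by metis
  have im: "v ` {..<k} = set (take k ?l)" if "k \<le> length ?l" for k
    using nth_image[OF that] by (simp add: v_def lessThan_atLeast0)
  have range: "v ` {..n} = V" using im[of "n + 1"] len l(1) by (simp add: lessThan_Suc_atMost)
  have inj: "inj_on v {..n}"
    using l(2) len unfolding inj_on_def v_def by (auto simp: nth_eq_iff_index_eq simp del: distinct_append)
  have frame: "affine_frame n v" using inj range V(1) by (simp add: affine_frame_def)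
  have "card A = length xs" using xs distinct_card by metis
  then have vA: "v ` {..<card A} = A" and cA: "card A \<le> n + 1"
    using im[of "card A"] xs len by auto
  have "card M \<le> n + 1" using card_mono[OF fin V(3)] n by simp
  have vM: "v ` {..<card M} = M"
  proof (cases "M = {}")
    case False
    have "card M = length (xs @ ys)"
      using distinct_card[of "xs @ ys"] xs ys B False by (auto simp: B_def Un_absorb1)
    then show ?thesis using im[of "card M"] xs ys B(1) len False by (auto simp: B_def)
  qed simp
  have "A \<subseteq> vertex_support V x \<and> \<not> vertex_support V x \<subseteq> M \<longleftrightarrow>
      {..<card A} \<subseteq> {i. bary n v x i \<noteq> 0} \<and> \<not> {i. bary n v x i \<noteq> 0} \<subseteq> {..<card M}"
    if x: "x \<in> convex hull V" for x
  proof -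
    have "i \<le> n" if "bary n v x i \<noteq> 0" for i
      using bary(1)[OF frame, of x] x that range by (metis weights_def not_le)
    then have "{i. bary n v x i \<noteq> 0} \<subseteq> {..n}" by blast
    moreover have "{..<card A} \<subseteq> {..n}" "{..<card M} \<subseteq> {..n}" using cA \<open>card M \<le> n + 1\<close> by auto
    moreover have "vertex_support V x = v ` {i. bary n v x i \<noteq> 0}"
      using vertex_support_bary[OF frame, of x] x range by simp
    ultimately show ?thesis using inj_on_image_subset_iff[OF inj] vA vM by metis
  qed
  then have "vertex_tile V A M = labelled_tile n v (card A) (card M)"
    unfolding vertex_tile_def labelled_tile_def range by blast
  then show ?thesis using frame range by blast
qed

lemma extreme_points_Times:
  fixes X :: "'a::euclidean_space set" and Y :: "'b::euclidean_space set"
  shows "{u. u extreme_point_of X \<times> Y} = {x. x extreme_point_of X} \<times> {y. y extreme_point_of Y}"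
proof -
  have "(x, y) extreme_point_of X \<times> Y \<longleftrightarrow> x extreme_point_of X \<and> y extreme_point_of Y" for x y
    using face_of_Times_eq[of "{x}" "{y}" X Y] by (simp add: face_of_singleton)
  then show ?thesis by auto
qed

locale labelled_product =
  fixes n1 n2 :: nat and v :: "nat \<Rightarrow> 'a::euclidean_space" and w :: "nat \<Rightarrow> 'b::euclidean_space"
  assumes frames: "affine_frame n1 v" "affine_frame n2 w"
begin

abbreviation "Q \<equiv> (convex hull (v ` {..n1})) \<times> (convex hull (w ` {..n2}))"

lemma realization:
  "geometric_realization (grid_chains n1 n2) (grid_point v w) Q (staircase_support n1 v n2 w)"
  using staircase_realization[OF frames] .

lemma vertices: "grid_point v w ` ({..n1} \<times> {..n2}) = {u. u extreme_point_of Q}"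
proof -
  have "{x. x extreme_point_of convex hull (v ` {..n1})} = v ` {..n1}"
    "{y. y extreme_point_of convex hull (w ` {..n2})} = w ` {..n2}"
    using frames extreme_point_of_convex_hull_affine_independent by (auto simp: affine_frame_def)
  then show ?thesis unfolding extreme_points_Times grid_point_def by force
qed

lemma product_pattern:
  "labelled_tile n1 v a1 m1 \<times> labelled_tile n2 w a2 m2 =
     {x \<in> Q. grid_pattern a1 m1 a2 m2 (staircase_support n1 v n2 w x)}"
proof -
  have "(x, y) \<in> labelled_tile n1 v a1 m1 \<times> labelled_tile n2 w a2 m2 \<longleftrightarrow>
      (x, y) \<in> Q \<and> grid_pattern a1 m1 a2 m2 (staircase_support n1 v n2 w (x, y))" for x y
    using staircase_support_projections[OF frames, of x y]
    by (cases "(x, y) \<in> Q") (simp_all add: labelled_tile_def grid_pattern_def conj_ac, blast)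
  then show ?thesis by auto
qed

lemma swapped_pattern:
  "labelled_tile n1 v a1 m1 \<times> labelled_tile n2 w a2 m2 =
     {x \<in> Q. grid_pattern a2 m2 a1 m1 (prod.swap ` staircase_support n1 v n2 w x)}"
  unfolding product_pattern by (auto simp: grid_pattern_def image_image)

lemma swapped_vertices:
  "(grid_point v w \<circ> prod.swap) ` ({..n2} \<times> {..n1}) = {u. u extreme_point_of Q}"
  unfolding vertices[symmetric] image_comp[symmetric] by (simp add: product_swap)

end


lemma reduced_card_bounds:
  assumes d: "reduced_tile_data V A M" and n: "card V = n + 1"
  shows "card A \<le> Suc n" "card M \<le> n" "card M = 0 \<or> 1 \<le> card A"
    "A \<noteq> V \<Longrightarrow> card A \<le> n" "A \<noteq> M \<Longrightarrow> 1 \<le> card A \<and> (card M = 0 \<or> card A < card M)"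
proof -
  have V: "\<not> affine_dependent V" "A \<subseteq> V" "M \<subset> V" "M \<noteq> {} \<Longrightarrow> A \<noteq> {} \<and> A \<subseteq> M"
    using d by (auto simp: reduced_tile_data_def tile_data_def)
  have fin: "finite V" using V(1) by (rule aff_independent_finite)
  then have fins: "finite A" "finite M" using V finite_subset by blast+
  show "card A \<le> Suc n" using card_mono[OF fin V(2)] n by simp
  show "card M \<le> n" using psubset_card_mono[OF fin V(3)] n by simp
  show "card M = 0 \<or> 1 \<le> card A" using V(4) fins by (auto simp: Suc_le_eq card_gt_0_iff)
  show "card A \<le> n" if "A \<noteq> V"
    using psubset_card_mono[OF fin, of A] V(2) that n by (simp add: psubset_eq)
  show "1 \<le> card A \<and> (card M = 0 \<or> card A < card M)" if "A \<noteq> M"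
  proof (cases "M = {}")
    case True
    then show ?thesis using that fins by (simp add: Suc_le_eq card_gt_0_iff)
  next
    case False
    then show ?thesis using V(4) that fins psubset_card_mono[OF fins(2), of A]
      by (simp add: Suc_le_eq card_gt_0_iff psubset_eq)
  qed
qed

lemma morse_tile_labelling:
  fixes T :: "'a::euclidean_space set"
  assumes "morse_tile_on n k \<sigma> \<mu> T"
  obtains v a m where "affine_frame n v" "\<sigma> = convex hull (v ` {..n})" "T = labelled_tile n v a m"
    "closure T = \<sigma>" "a \<le> Suc n" "m \<le> n" "m = 0 \<or> 1 \<le> a" "\<mu> = {} \<Longrightarrow> m = 0"
    "\<not> critical_tile T \<Longrightarrow> 1 \<le> a \<and> a \<le> n \<and> (m = 0 \<or> a < m)"
proof -
  obtain V A M where d: "reduced_tile_data V A M" "card V = n + 1" "\<sigma> = convex hull V"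
      "\<mu> = convex hull M" "T = vertex_tile V A M"
    using assms unfolding morse_tile_on_iff_vertex_tile by blast
  have td: "tile_data V A M" "M = {} \<or> A \<subseteq> M" using d(1) by (auto simp: reduced_tile_data_def)
  obtain v where v: "affine_frame n v" "v ` {..n} = V"
      "vertex_tile V A M = labelled_tile n v (card A) (card M)"
    using vertex_labelling[OF td d(2)] by blast
  have "A \<noteq> M \<and> A \<noteq> V" if "\<not> critical_tile T"
    using that critical_reduced_iff[OF d(1)] d(2,5)
    unfolding critical_tile_def critical_data_def by auto
  then have reg: "1 \<le> card A \<and> card A \<le> n \<and> (card M = 0 \<or> card A < card M)" if "\<not> critical_tile T"
    using reduced_card_bounds[OF d(1,2)] that by blast
  show thesis
  proof (rule that[OF v(1)])
    show "\<sigma> = convex hull (v ` {..n})" "closure T = \<sigma>" "T = labelled_tile n v (card A) (card M)"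
      using d v vertex_tile_closure[OF td(1)] by auto
    show "card M = 0" if "\<mu> = {}" using that d(4) by simp
  qed (use reg reduced_card_bounds[OF d(1,2)] in auto)
qed

lemma critical_tile_labelling:
  fixes T :: "'a::euclidean_space set"
  assumes "morse_tile_on n k \<sigma> \<mu> T" "critical_tile_of_index i T"
  obtains v where "affine_frame n v" "\<sigma> = convex hull (v ` {..n})" "T = labelled_tile n v i i"
    "closure T = \<sigma>" "i \<le> n"
proof -
  obtain V A M where d: "reduced_tile_data V A M" "card V = n + 1" "\<sigma> = convex hull V"
      "T = vertex_tile V A M"
    using assms unfolding morse_tile_on_iff_vertex_tile by blast
  obtain B where B: "tile_data V B B" "card B = i" "vertex_tile V B B = T"
    using critical_tile_symmetric_data[OF d(1)] assms(2) d(4) by blast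
  have V: "\<not> affine_dependent V" "B \<subset> V" using B by (auto simp: tile_data_def)
  have "i \<le> n"
    using psubset_card_mono[OF aff_independent_finite[OF V(1)] V(2)] B(2) d(2) by simp
  moreover obtain v where "affine_frame n v" "v ` {..n} = V" "vertex_tile V B B = labelled_tile n v i i"
    using vertex_labelling[OF B(1) _ d(2)] B(2) by auto
  ultimately show thesis using that d B vertex_tile_closure[OF B(1)] by metis
qed

lemma critical_index_unique:
  assumes "morse_tile_on n k \<sigma> \<mu> T" "critical_tile_of_index i T" "critical_tile_of_index j T"
  shows "i = j"
proof -
  obtain V A M where d: "reduced_tile_data V A M" "T = vertex_tile V A M"
    using assms unfolding morse_tile_on_iff_vertex_tile by blast
  obtain B where B: "tile_data V B B" "card B = i" "vertex_tile V B B = T"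
    using critical_tile_symmetric_data[OF d(1)] assms(2) d(2) by blast
  have "B \<noteq> V" using B(1) by (auto simp: tile_data_def)
  then show ?thesis
    using critical_vertex_tile_iff[OF B(1), of j] assms(3) B by (auto simp: critical_data_def)
qed

text \<open>The regular tile has to be the first factor of the grid, since its column 0 is prescribed and its last
column is not, whatever the other tile is.\<close>

lemma product_shelling_regular:
  fixes T1 :: "'a::euclidean_space set" and T2 :: "'b::euclidean_space set"
  assumes t: "morse_tile_on n1 k1 \<sigma>1 \<mu>1 T1" "morse_tile_on n2 k2 \<sigma>2 \<mu>2 T2"
    and reg: "\<not> critical_tile T1 \<or> \<not> critical_tile T2"
  shows "\<exists>\<T>. tame_shelling_on {u. u extreme_point_of \<sigma>1 \<times> \<sigma>2} (\<sigma>1 \<times> \<sigma>2) (T1 \<times> T2) \<T> \<and>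
    (\<forall>T\<in>\<T>. \<not> critical_tile T) \<and> (\<mu>1 = {} \<and> \<mu>2 = {} \<longrightarrow> (\<forall>T\<in>\<T>. basic_tile T))"
proof -
  obtain v a1 m1 where v: "affine_frame n1 v" "\<sigma>1 = convex hull (v ` {..n1})"
      "T1 = labelled_tile n1 v a1 m1" "closure T1 = \<sigma>1" and m1: "\<mu>1 = {} \<Longrightarrow> m1 = 0"
      and b1: "a1 \<le> Suc n1" "m1 \<le> n1" "m1 = 0 \<or> 1 \<le> a1"
      and r1: "\<not> critical_tile T1 \<Longrightarrow> 1 \<le> a1 \<and> a1 \<le> n1 \<and> (m1 = 0 \<or> a1 < m1)"
    by (rule morse_tile_labelling[OF t(1)]) (rule that)
  obtain w a2 m2 where w: "affine_frame n2 w" "\<sigma>2 = convex hull (w ` {..n2})"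
      "T2 = labelled_tile n2 w a2 m2" "closure T2 = \<sigma>2" and m2: "\<mu>2 = {} \<Longrightarrow> m2 = 0"
      and b2: "a2 \<le> Suc n2" "m2 \<le> n2" "m2 = 0 \<or> 1 \<le> a2"
      and r2: "\<not> critical_tile T2 \<Longrightarrow> 1 \<le> a2 \<and> a2 \<le> n2 \<and> (m2 = 0 \<or> a2 < m2)"
    by (rule morse_tile_labelling[OF t(2)]) (rule that)
  interpret labelled_product n1 n2 v w using v(1) w(1) by unfold_locales
  have Q: "\<sigma>1 \<times> \<sigma>2 = Q" using v(2) w(2) by simp
  have dense: "closure (T1 \<times> T2) = \<sigma>1 \<times> \<sigma>2" using v(4) w(4) by (simp add: closure_Times)
  have ms: "m1 = 0 \<and> m2 = 0" if "\<mu>1 = {} \<and> \<mu>2 = {}" using that m1 m2 by blast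
  have direct: "T1 \<times> T2 = {x \<in> Q. grid_pattern a1 m1 a2 m2 (staircase_support n1 v n2 w x)}"
    unfolding v(3) w(3) by (rule product_pattern)
  have swapped: "T1 \<times> T2 = {x \<in> Q. grid_pattern a2 m2 a1 m1 (prod.swap ` staircase_support n1 v n2 w x)}"
    unfolding v(3) w(3) by (rule swapped_pattern)
  show ?thesis
  proof (cases "critical_tile T1")
    case False
    have h: "1 \<le> a1" "a1 \<le> n1" "m1 = 0 \<or> a1 < m1 \<and> m1 \<le> n1" using r1[OF False] b1(2) by auto
    show ?thesis
      using regular_staircase_shelling[OF realization h(1,2) b2(1) h(3) b2(2,3)
          direct dense[unfolded Q], unfolded vertices, folded Q] ms
      by (elim ex_forward) auto
  next
    case True
    then have "\<not> critical_tile T2" using reg by blast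
    then have h: "1 \<le> a2" "a2 \<le> n2" "m2 = 0 \<or> a2 < m2 \<and> m2 \<le> n2" using r2 b2(2) by auto
    show ?thesis
      using regular_staircase_shelling[OF geometric_realization_swap[OF realization] h(1,2) b1(1) h(3) b1(2,3)
          swapped dense[unfolded Q], unfolded swapped_vertices, folded Q] ms
      by (elim ex_forward) auto
  qed
qed

text \<open>The only exception to the conditions on the numbering is a closed simplex times a critical tile of
positive index; then the factors are exchanged.\<close>

lemma product_shelling_critical:
  fixes T1 :: "'a::euclidean_space set" and T2 :: "'b::euclidean_space set"
  assumes t: "morse_tile_on n1 k1 \<sigma>1 \<mu>1 T1" "morse_tile_on n2 k2 \<sigma>2 \<mu>2 T2"
    and crit: "critical_tile_of_index i1 T1" "critical_tile_of_index i2 T2"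
  shows "\<exists>\<T>. tame_shelling_on {u. u extreme_point_of \<sigma>1 \<times> \<sigma>2} (\<sigma>1 \<times> \<sigma>2) (T1 \<times> T2) \<T> \<and>
    (\<exists>!T. T \<in> \<T> \<and> critical_tile T) \<and>
    (\<forall>T\<in>\<T>. critical_tile T \<longrightarrow> critical_tile_of_index (i1 + i2) T)"
proof -
  obtain v where v: "affine_frame n1 v" "\<sigma>1 = convex hull (v ` {..n1})"
      "T1 = labelled_tile n1 v i1 i1" "closure T1 = \<sigma>1" and i1: "i1 \<le> n1"
    by (rule critical_tile_labelling[OF t(1) crit(1)])
  obtain w where w: "affine_frame n2 w" "\<sigma>2 = convex hull (w ` {..n2})"
      "T2 = labelled_tile n2 w i2 i2" "closure T2 = \<sigma>2" and i2: "i2 \<le> n2"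
    by (rule critical_tile_labelling[OF t(2) crit(2)])
  interpret labelled_product n1 n2 v w using v(1) w(1) by unfold_locales
  have Q: "\<sigma>1 \<times> \<sigma>2 = Q" using v(2) w(2) by simp
  have dense: "closure (T1 \<times> T2) = \<sigma>1 \<times> \<sigma>2" using v(4) w(4) by (simp add: closure_Times)
  have direct: "T1 \<times> T2 = {x \<in> Q. grid_pattern i1 i1 i2 i2 (staircase_support n1 v n2 w x)}"
    unfolding v(3) w(3) by (rule product_pattern)
  have swapped: "T1 \<times> T2 = {x \<in> Q. grid_pattern i2 i2 i1 i1 (prod.swap ` staircase_support n1 v n2 w x)}"
    unfolding v(3) w(3) by (rule swapped_pattern)
  show ?thesis
  proof (cases "i2 = 0 \<or> 1 \<le> i1")
    case True
    show ?thesis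
      using critical_staircase_shelling[OF realization i1 i2 True
          direct dense[unfolded Q], unfolded vertices, folded Q] .
  next
    case False
    then have h: "i1 = 0 \<or> 1 \<le> i2" by auto
    show ?thesis
      using critical_staircase_shelling[OF geometric_realization_swap[OF realization] i2 i1 h
          swapped dense[unfolded Q], unfolded swapped_vertices, folded Q]
      by (simp add: add.commute)
  qed
qed

theorem theorem3p14:
  fixes T1 \<sigma>1 :: "'a::euclidean_space set"
    and T2 \<sigma>2 :: "'b::euclidean_space set"
  shows "(\<forall>n1 k1 n2 k2.
      basic_tile_on n1 k1 \<sigma>1 T1 \<and> basic_tile_on n2 k2 \<sigma>2 T2 \<and>
      (regular_tile T1 \<or> regular_tile T2) \<longrightarrow>
        (\<exists>K \<T> N P. primitive_triangulation K \<sigma>1 \<sigma>2 \<and>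
            shelling K (T1 \<times> T2) \<T> N P \<and>
            (\<forall>T\<in>\<T>. regular_tile T) \<and>
            tame K (T1 \<times> T2) \<T> \<and> pure_dimensional \<T>)) \<and>
    (\<forall>n1 k1 \<mu>1 n2 k2 \<mu>2.
      morse_tile_on n1 k1 \<sigma>1 \<mu>1 T1 \<and> morse_tile_on n2 k2 \<sigma>2 \<mu>2 T2 \<longrightarrow>
        (\<exists>K \<T> N P. primitive_triangulation K \<sigma>1 \<sigma>2 \<and>
            morse_shelling K (T1 \<times> T2) \<T> N P \<and>
            ((\<exists>T\<in>\<T>. critical_tile T) \<longleftrightarrow> critical_tile T1 \<and> critical_tile T2) \<and>
            (\<forall>i1 i2. critical_tile_of_index i1 T1 \<and> critical_tile_of_index i2 T2 \<longrightarrow>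
               (\<exists>!T. T \<in> \<T> \<and> critical_tile T) \<and>
               (\<forall>T\<in>\<T>. critical_tile T \<longrightarrow> critical_tile_of_index (i1 + i2) T)) \<and>
            tame K (T1 \<times> T2) \<T> \<and> pure_dimensional \<T>))"
proof (intro conjI allI impI)
  fix n1 k1 n2 k2
  assume *: "basic_tile_on n1 k1 \<sigma>1 T1 \<and> basic_tile_on n2 k2 \<sigma>2 T2 \<and>
    (regular_tile T1 \<or> regular_tile T2)"
  then have t: "morse_tile_on n1 k1 \<sigma>1 {} T1" "morse_tile_on n2 k2 \<sigma>2 {} T2"
    and reg: "\<not> critical_tile T1 \<or> \<not> critical_tile T2"
    by (auto simp: basic_tile_on_iff_morse regular_tile_def)
  obtain \<T> where \<T>: "tame_shelling_on {u. u extreme_point_of \<sigma>1 \<times> \<sigma>2} (\<sigma>1 \<times> \<sigma>2) (T1 \<times> T2) \<T>"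
      "\<forall>T\<in>\<T>. \<not> critical_tile T" "\<forall>T\<in>\<T>. basic_tile T"
    using product_shelling_regular[OF t reg] by (elim exE conjE) simp
  then obtain K N P where "primitive_triangulation K \<sigma>1 \<sigma>2" "morse_shelling K (T1 \<times> T2) \<T> N P"
      "tame K (T1 \<times> T2) \<T>" "pure_dimensional \<T>"
    unfolding tame_shelling_on_def primitive_triangulation_def by blast
  moreover have "\<forall>T\<in>\<T>. regular_tile T"
    using \<T>(2,3) unfolding regular_tile_def basic_tile_def morse_tile_def morse_tile_dim_def
      basic_tile_on_iff_morse by blast
  ultimately show "\<exists>K \<T> N P. primitive_triangulation K \<sigma>1 \<sigma>2 \<and>
      shelling K (T1 \<times> T2) \<T> N P \<and> (\<forall>T\<in>\<T>. regular_tile T) \<and>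
      tame K (T1 \<times> T2) \<T> \<and> pure_dimensional \<T>"
    using \<T>(3) unfolding shelling_def by blast
next
  fix n1 k1 \<mu>1 n2 k2 \<mu>2
  assume "morse_tile_on n1 k1 \<sigma>1 \<mu>1 T1 \<and> morse_tile_on n2 k2 \<sigma>2 \<mu>2 T2"
  then have t: "morse_tile_on n1 k1 \<sigma>1 \<mu>1 T1" "morse_tile_on n2 k2 \<sigma>2 \<mu>2 T2" by auto
  have "\<exists>\<T>. tame_shelling_on {u. u extreme_point_of \<sigma>1 \<times> \<sigma>2} (\<sigma>1 \<times> \<sigma>2) (T1 \<times> T2) \<T> \<and>
      ((\<exists>T\<in>\<T>. critical_tile T) \<longleftrightarrow> critical_tile T1 \<and> critical_tile T2) \<and>
      (\<forall>i1 i2. critical_tile_of_index i1 T1 \<and> critical_tile_of_index i2 T2 \<longrightarrow>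
        (\<exists>!T. T \<in> \<T> \<and> critical_tile T) \<and>
        (\<forall>T\<in>\<T>. critical_tile T \<longrightarrow> critical_tile_of_index (i1 + i2) T))"
  proof (cases "critical_tile T1 \<and> critical_tile T2")
    case True
    then obtain j1 j2 where j: "critical_tile_of_index j1 T1" "critical_tile_of_index j2 T2"
      unfolding critical_tile_def by blast
    obtain \<T> where \<T>: "tame_shelling_on {u. u extreme_point_of \<sigma>1 \<times> \<sigma>2} (\<sigma>1 \<times> \<sigma>2) (T1 \<times> T2) \<T>"
        "\<exists>!T. T \<in> \<T> \<and> critical_tile T"
        "\<forall>T\<in>\<T>. critical_tile T \<longrightarrow> critical_tile_of_index (j1 + j2) T"
      using product_shelling_critical[OF t j] by (elim exE conjE)
    have "i1 = j1 \<and> i2 = j2" if "critical_tile_of_index i1 T1 \<and> critical_tile_of_index i2 T2" for i1 i2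
      using that critical_index_unique[OF t(1) _ j(1)] critical_index_unique[OF t(2) _ j(2)] by blast
    moreover have "\<exists>T\<in>\<T>. critical_tile T" using \<T>(2) by blast
    ultimately show ?thesis using \<T> True by (intro exI[of _ \<T>] conjI allI impI) simp_all
  next
    case False
    then have reg: "\<not> critical_tile T1 \<or> \<not> critical_tile T2" by blast
    obtain \<T> where \<T>: "tame_shelling_on {u. u extreme_point_of \<sigma>1 \<times> \<sigma>2} (\<sigma>1 \<times> \<sigma>2) (T1 \<times> T2) \<T>"
        "\<forall>T\<in>\<T>. \<not> critical_tile T"
      using product_shelling_regular[OF t reg] by (elim exE conjE)
    have "\<not> (critical_tile_of_index i1 T1 \<and> critical_tile_of_index i2 T2)" for i1 i2
      using False unfolding critical_tile_def by blast
    then show ?thesis using \<T> False by (intro exI[of _ \<T>] conjI allI impI) (simp_all, blast+)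
  qed
  then obtain \<T> where \<T>: "tame_shelling_on {u. u extreme_point_of \<sigma>1 \<times> \<sigma>2} (\<sigma>1 \<times> \<sigma>2) (T1 \<times> T2) \<T>"
    and crit: "(\<exists>T\<in>\<T>. critical_tile T) \<longleftrightarrow> critical_tile T1 \<and> critical_tile T2"
      "\<forall>i1 i2. critical_tile_of_index i1 T1 \<and> critical_tile_of_index i2 T2 \<longrightarrow>
        (\<exists>!T. T \<in> \<T> \<and> critical_tile T) \<and>
        (\<forall>T\<in>\<T>. critical_tile T \<longrightarrow> critical_tile_of_index (i1 + i2) T)"
    by (elim exE conjE)
  from \<T> obtain K N P where "primitive_triangulation K \<sigma>1 \<sigma>2" "morse_shelling K (T1 \<times> T2) \<T> N P"
      "tame K (T1 \<times> T2) \<T>" "pure_dimensional \<T>"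
    unfolding tame_shelling_on_def primitive_triangulation_def by blast
  with crit show "\<exists>K \<T> N P. primitive_triangulation K \<sigma>1 \<sigma>2 \<and>
      morse_shelling K (T1 \<times> T2) \<T> N P \<and>
      ((\<exists>T\<in>\<T>. critical_tile T) \<longleftrightarrow> critical_tile T1 \<and> critical_tile T2) \<and>
      (\<forall>i1 i2. critical_tile_of_index i1 T1 \<and> critical_tile_of_index i2 T2 \<longrightarrow>
         (\<exists>!T. T \<in> \<T> \<and> critical_tile T) \<and>
         (\<forall>T\<in>\<T>. critical_tile T \<longrightarrow> critical_tile_of_index (i1 + i2) T)) \<and>
      tame K (T1 \<times> T2) \<T> \<and> pure_dimensional \<T>"
    by (intro exI[of _ K] exI[of _ \<T>] exI[of _ N] exI[of _ P] conjI)
qed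

end
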